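(* There exists a universal constant $C>0$ such that for every $n\ge1$, every real matrix $A=(a_{ij})_{i,j\le n}$ and every real $p\ge1$, $$\frac12\max_{I\subset[n]\times[n],\,|I|\le p}\big\|(|a_{ij}|\mathbf{1}_{\{(i,j)\in I\}})_{i,j\le n}\big\|\ \le\ \|A\|_{\varepsilon,p}\ \le\ C\sqrt{\ln(p+1)}\max_{I\subset[n]\times[n],\,|I|\le p}\big\|(|a_{ij}|\mathbf{1}_{\{(i,j)\in I\}})_{i,j\le n}\big\|.$$
   Context: $[n]=\{1,\dots,n\}$. For a matrix, $\|\cdot\|$ is the operator norm from $\ell_2^n$ to $\ell_2^n$. For $p\ge1$, $$\|A\|_{\varepsilon,p}:=\sup_{\|s\|_2,\|t\|_2\le1}\Big\|\sum_{i,j=1}^n a_{ij}\varepsilon_{ij}s_it_j\Big\|_p,$$ where $(\varepsilon_{ij})_{i,j\le n}$ are independent symmetric $\pm1$ random variables, the supremum is over $s,t\in\mathbb{R}^n$, $\|S\|_p=(\mathbb{E}|S|^p)^{1/p}$ for a random variable $S$, and $\|x\|_2$ is the Euclidean norm of a vector $x$. *)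

theory Defs
  imports "HOL-Probability.Probability"
begin

text \<open>
  The dimension varies inside the statement (the constant must not depend on it), so vectors are
  functions \<open>nat \<Rightarrow> real\<close> and matrices functions \<open>nat \<Rightarrow> nat \<Rightarrow> real\<close>, of which only
  the entries with indices in \<open>{1..n}\<close> are ever used. The Euclidean norm is \<open>L2_set x {1..n}\<close>.
\<close>

definition op_norm :: "nat \<Rightarrow> (nat \<Rightarrow> nat \<Rightarrow> real) \<Rightarrow> real" where
  "op_norm n B =
     (SUP x\<in>{x. L2_set x {1..n} \<le> 1}. L2_set (\<lambda>i. \<Sum>j\<in>{1..n}. B i j * x j) {1..n})"

definition restrict_abs :: "(nat \<Rightarrow> nat \<Rightarrow> real) \<Rightarrow> (nat \<times> nat) set \<Rightarrow> nat \<Rightarrow> nat \<Rightarrow> real" where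
  "restrict_abs A I = (\<lambda>i j. \<bar>A i j\<bar> * indicator I (i, j))"

definition max_restricted_norm :: "nat \<Rightarrow> (nat \<Rightarrow> nat \<Rightarrow> real) \<Rightarrow> real \<Rightarrow> real" where
  "max_restricted_norm n A p =
     Max ((\<lambda>I. op_norm n (restrict_abs A I)) `
          {I. I \<subseteq> {1..n} \<times> {1..n} \<and> real (card I) \<le> p})"

definition Lp_norm :: "'w measure \<Rightarrow> real \<Rightarrow> ('w \<Rightarrow> real) \<Rightarrow> real" where
  "Lp_norm M p S = (LINT \<omega>|M. \<bar>S \<omega>\<bar> powr p) powr (1 / p)"

definition rademacher_family :: "'w measure \<Rightarrow> ('i \<Rightarrow> 'w \<Rightarrow> real) \<Rightarrow> 'i set \<Rightarrow> bool" where
  "rademacher_family M \<epsilon> I \<longleftrightarrow>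
     prob_space M \<and> prob_space.indep_vars M (\<lambda>_. borel) \<epsilon> I \<and>
     (\<forall>i\<in>I. measure M {\<omega>\<in>space M. \<epsilon> i \<omega> = 1} = 1 / 2 \<and>
            measure M {\<omega>\<in>space M. \<epsilon> i \<omega> = -1} = 1 / 2)"

definition eps_norm_on ::
  "'w measure \<Rightarrow> (nat \<times> nat \<Rightarrow> 'w \<Rightarrow> real) \<Rightarrow> nat \<Rightarrow> real \<Rightarrow> (nat \<Rightarrow> nat \<Rightarrow> real) \<Rightarrow> real" where
  "eps_norm_on M \<epsilon> n p A =
     (SUP (s, t)\<in>{(s, t). L2_set s {1..n} \<le> 1 \<and> L2_set t {1..n} \<le> 1}.
        Lp_norm M p (\<lambda>\<omega>. \<Sum>i\<in>{1..n}. \<Sum>j\<in>{1..n}. A i j * \<epsilon> (i, j) \<omega> * s i * t j))"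

text \<open>
  The norm depends only on the joint law of the signs. We fix the canonical realization, so that no
  type of sample points occurs in statements quantifying over \<open>n\<close>; the theorem
  \<open>eps_norm_on_eq\<close> below shows that every other realization yields the same value.
\<close>

definition sign_pmf :: "nat \<Rightarrow> (nat \<times> nat \<Rightarrow> real) pmf" where
  "sign_pmf n = Pi_pmf ({1..n} \<times> {1..n}) 0 (\<lambda>_. pmf_of_set {-1, 1})"

definition eps_norm :: "nat \<Rightarrow> real \<Rightarrow> (nat \<Rightarrow> nat \<Rightarrow> real) \<Rightarrow> real" where
  "eps_norm n p A = eps_norm_on (measure_pmf (sign_pmf n)) (\<lambda>ij \<omega>. \<omega> ij) n p A"

lemma rademacher_family_sign_pmf:
  "rademacher_family (measure_pmf (sign_pmf n)) (\<lambda>ij \<omega>. \<omega> ij) ({1..n} \<times> {1..n})"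
proof -
  let ?M = "measure_pmf (sign_pmf n)" and ?I = "{1..n} \<times> {1..n}"
  have "prob_space.indep_vars ?M (\<lambda>_. count_space UNIV) (\<lambda>ij \<omega>. \<omega> ij) ?I"
    unfolding sign_pmf_def by (rule indep_vars_Pi_pmf) simp
  then have ind: "prob_space.indep_vars ?M (\<lambda>_. borel) (\<lambda>ij \<omega>. \<omega> ij) ?I"
    by (rule prob_space.indep_vars_compose2[OF measure_pmf.prob_space_axioms, where Y = "\<lambda>_ x. x"]) auto
  have marg: "measure (measure_pmf (sign_pmf n)) {\<omega>. \<omega> ij = c} = 1 / 2"
    if "ij \<in> {1..n} \<times> {1..n}" "c \<in> {-1, 1}" for ij and c :: real
  proof -
    have "measure (measure_pmf (sign_pmf n)) {\<omega>. \<omega> ij = c}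
        = pmf (map_pmf (\<lambda>\<omega>. \<omega> ij) (sign_pmf n)) c"
      by (simp add: pmf_map vimage_def)
    also have "map_pmf (\<lambda>\<omega>. \<omega> ij) (sign_pmf n) = pmf_of_set {-1, 1}"
      unfolding sign_pmf_def by (subst Pi_pmf_component) (use that in auto)
    finally show ?thesis using that by simp
  qed
  show ?thesis
    unfolding rademacher_family_def using ind marg measure_pmf.prob_space_axioms by auto
qed

lemma rademacher_law:
  assumes "rademacher_family M \<epsilon> I" "i \<in> I"
  shows "distr M borel (\<epsilon> i) = distr (measure_pmf (pmf_of_set {-1, 1})) borel (\<lambda>x. x)"
proof -
  interpret prob_space M using assms unfolding rademacher_family_def by auto
  have rv [measurable]: "\<epsilon> i \<in> borel_measurable M"
    using assms unfolding rademacher_family_def indep_vars_def by auto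
  have half: "prob {\<omega>\<in>space M. \<epsilon> i \<omega> = 1} = 1 / 2" "prob {\<omega>\<in>space M. \<epsilon> i \<omega> = -1} = 1 / 2"
    using assms unfolding rademacher_family_def by auto
  let ?P = "{\<omega>\<in>space M. \<epsilon> i \<omega> = 1}" and ?N = "{\<omega>\<in>space M. \<epsilon> i \<omega> = -1}"
  have "prob (?P \<union> ?N) = prob ?P + prob ?N"
    by (rule finite_measure_Union) auto
  then have "AE \<omega> in M. \<omega> \<in> ?P \<union> ?N"
    using half by (subst AE_in_set_eq_1) auto
  then have ae: "AE \<omega> in M. \<epsilon> i \<omega> = 1 \<or> \<epsilon> i \<omega> = -1" by eventually_elim auto
  interpret D: prob_space "distr M borel (\<epsilon> i)" by (rule prob_space_distr) simp
  interpret E: prob_space "distr (measure_pmf (pmf_of_set {-1, 1::real})) borel (\<lambda>x. x)"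
    by (rule measure_pmf.prob_space_distr) simp
  show ?thesis
  proof (rule measure_eqI)
    fix B assume "B \<in> sets (distr M borel (\<epsilon> i))"
    then have B [measurable]: "B \<in> sets borel" by simp
    have "measure (distr M borel (\<epsilon> i)) B = expectation (\<lambda>\<omega>. indicator B (\<epsilon> i \<omega>))"
      by (subst integral_distr[symmetric, where N = borel]) auto
    also have "\<dots> = expectation (\<lambda>\<omega>. indicator B 1 * indicator ?P \<omega> + indicator B (-1) * indicator ?N \<omega>)"
      by (rule integral_cong_AE) (use ae AE_space in \<open>auto elim!: eventually_elim2 simp: indicator_def\<close>)
    also have "\<dots> = indicator B 1 * prob ?P + indicator B (-1) * prob ?N"
      by (subst Bochner_Integration.integral_add) (auto intro!: integrable_real_indicator simp: emeasure_eq_measure)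
    also have "\<dots> = measure (measure_pmf (pmf_of_set {-1, 1})) B"
      unfolding half by (subst measure_pmf_of_set) (auto simp: indicator_def)
    also have "\<dots> = measure (distr (measure_pmf (pmf_of_set {-1, 1})) borel (\<lambda>x. x)) B"
      by (subst measure_distr) auto
    finally show "emeasure (distr M borel (\<epsilon> i)) B
        = emeasure (distr (measure_pmf (pmf_of_set {-1, 1})) borel (\<lambda>x. x)) B"
      by (simp only: D.emeasure_eq_measure E.emeasure_eq_measure)
  qed simp
qed

lemma Lp_norm_rademacher_eq:
  fixes A :: "nat \<Rightarrow> nat \<Rightarrow> real" and M :: "'w measure" and M' :: "'v measure"
  assumes R: "rademacher_family M \<epsilon> ({1..n} \<times> {1..n})"
    and R': "rademacher_family M' \<eta> ({1..n} \<times> {1..n})" and "n \<ge> 1"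
  shows "Lp_norm M p (\<lambda>\<omega>. \<Sum>i\<in>{1..n}. \<Sum>j\<in>{1..n}. A i j * \<epsilon> (i, j) \<omega> * s i * t j)
       = Lp_norm M' p (\<lambda>\<omega>. \<Sum>i\<in>{1..n}. \<Sum>j\<in>{1..n}. A i j * \<eta> (i, j) \<omega> * s i * t j)"
proof -
  let ?I = "{1..n} \<times> {1..n}"
  let ?P = "PiM ?I (\<lambda>_. distr (measure_pmf (pmf_of_set {-1, 1::real})) borel (\<lambda>x. x))"
  define g where "g x = \<bar>\<Sum>i\<in>{1..n}. \<Sum>j\<in>{1..n}. A i j * x (i, j) * s i * t j\<bar> powr p" for x
  have g_meas: "g \<in> borel_measurable (PiM ?I (\<lambda>_. borel))"
    unfolding g_def by measurable
  have *: "(LINT \<omega>|N. g (\<lambda>ij. \<xi> ij \<omega>)) = (LINT x|?P. g x)"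
    if "rademacher_family N \<xi> ?I" for N :: "'z measure" and \<xi>
  proof -
    interpret prob_space N using that unfolding rademacher_family_def by auto
    have ind: "indep_vars (\<lambda>_. borel) \<xi> ?I"
      using that unfolding rademacher_family_def by auto
    then have rv: "\<xi> ij \<in> borel_measurable N" if "ij \<in> ?I" for ij
      using that unfolding indep_vars_def by auto
    have "?I \<noteq> {}" using \<open>n \<ge> 1\<close> by auto
    from indep_vars_iff_distr_eq_PiM'[OF this, where M' = "\<lambda>_. borel"] rv ind
    have "distr N (PiM ?I (\<lambda>_. borel)) (\<lambda>x. \<lambda>ij\<in>?I. \<xi> ij x)
        = PiM ?I (\<lambda>ij. distr N borel (\<xi> ij))" by auto
    also have "\<dots> = ?P"
      by (rule PiM_cong) (use rademacher_law[OF that] in auto)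
    finally have law: "distr N (PiM ?I (\<lambda>_. borel)) (\<lambda>x. \<lambda>ij\<in>?I. \<xi> ij x) = ?P" .
    have "(LINT \<omega>|N. g (\<lambda>ij. \<xi> ij \<omega>)) = (LINT \<omega>|N. g (\<lambda>ij\<in>?I. \<xi> ij \<omega>))"
      by (simp add: g_def)
    also have "\<dots> = (LINT x|distr N (PiM ?I (\<lambda>_. borel)) (\<lambda>x. \<lambda>ij\<in>?I. \<xi> ij x). g x)"
      by (rule integral_distr[symmetric]) (use g_meas in \<open>auto intro!: measurable_restrict rv simp del: One_nat_def restrict_apply\<close>)
    finally show ?thesis unfolding law .
  qed
  have "(LINT \<omega>|M. g (\<lambda>ij. \<epsilon> ij \<omega>)) = (LINT \<omega>|M'. g (\<lambda>ij. \<eta> ij \<omega>))"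
    using *[OF R] *[OF R'] by simp
  then show ?thesis unfolding Lp_norm_def g_def by simp
qed

theorem eps_norm_on_eq:
  assumes "rademacher_family M \<epsilon> ({1..n} \<times> {1..n})" "n \<ge> 1"
  shows "eps_norm_on M \<epsilon> n p A = eps_norm n p A"
  unfolding eps_norm_def eps_norm_on_def
  using Lp_norm_rademacher_eq[OF assms(1) rademacher_family_sign_pmf assms(2)]
  by (intro SUP_cong) auto

end

theory Submission
  imports Defs
begin

text \<open>
  Lower bound: on the event that the signs with index in \<open>I\<close> agree with those of
  \<open>A i j * s i * t j\<close>, which has probability \<open>2 ^ (- card I) \<ge> 2 powr (- p)\<close>, the conditional mean
  of the chaos is \<open>\<Sum>\<^bsub>I\<^esub> \<bar>A i j * s i * t j\<bar>\<close>; Jensen's inequality applies.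

  Upper bound: let \<open>M\<close> be the maximal restricted norm, \<open>q = \<lfloor>p\<rfloor>\<close> and
  \<open>c i j = \<bar>A i j * s i * t j\<bar>\<close>. Fewer than \<open>q\<close> of the \<open>c i j\<close> exceed \<open>M / q\<close>, and they sum to
  at most \<open>M\<close>. For the rest, a subgaussian estimate reduces the claim to a bound
  \<open>\<Sum> (c i j)\<^sup>2 \<le> C * M\<^sup>2 * ln (p + 1) / q\<close>. Entries with \<open>\<bar>A i j\<bar> \<le> M / sqrt q\<close> contribute at most
  \<open>M\<^sup>2 / q\<close>. The remaining (heavy) entries number at most \<open>q\<close> in each row and column. A set of
  \<open>k\<^sup>2 * q\<close> of them splits, via balanced partitions of the rows and of the columns into \<open>k\<close>
  classes, into blocks with about \<open>q\<close> entries on average, whence \<open>\<Sum> c i j \<le> 3 * k * M\<close> over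
  that set. This is a weak \<open>L\<^sup>2\<close> bound on the level sets of \<open>c\<close>; only about \<open>ln p\<close> dyadic levels
  between \<open>M / q\<close> and \<open>M / q\<^sup>2\<close> matter.
\<close>

section \<open>Head and tail of a bilinear form with sparse norm bounds\<close>

text \<open>Greedy assignment: each new element joins a class whose load is at most the average, so
  its new load is at most the average plus one weight \<open>b\<close>. Both sides carry the factor
  \<open>k\<close> to keep the statement in the naturals.\<close>

lemma balanced_partition:
  fixes w :: "'a \<Rightarrow> nat"
  assumes "finite A" "\<And>i. i \<in> A \<Longrightarrow> w i \<le> b" "k \<ge> 1"
  shows "\<exists>f. (\<forall>i\<in>A. f i < k) \<and>
    (\<forall>u<k. k * (\<Sum>i\<in>{i\<in>A. f i = u}. w i) \<le> (\<Sum>i\<in>A. w i) + k * b)"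
  using assms(1,2)
proof (induction A rule: finite_induct)
  case (insert e A)
  then obtain f where f: "\<And>i. i \<in> A \<Longrightarrow> f i < k"
    and le: "\<And>u. u < k \<Longrightarrow> k * (\<Sum>i\<in>{i\<in>A. f i = u}. w i) \<le> (\<Sum>i\<in>A. w i) + k * b"
    by auto
  define W where "W u = (\<Sum>i\<in>{i\<in>A. f i = u}. w i)" for u
  have tot: "(\<Sum>u<k. W u) = (\<Sum>i\<in>A. w i)"
    unfolding W_def by (rule sum.group) (use insert.hyps f in auto)
  have "\<exists>u<k. k * W u \<le> (\<Sum>i\<in>A. w i)"
  proof (rule ccontr)
    assume "\<not> ?thesis"
    then have "\<And>u. u < k \<Longrightarrow> (\<Sum>i\<in>A. w i) < k * W u" by force
    then have "(\<Sum>u<k. \<Sum>i\<in>A. w i) < (\<Sum>u<k. k * W u)"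
      using \<open>k \<ge> 1\<close> by (intro sum_strict_mono) (auto simp: lessThan_empty_iff)
    then show False by (simp add: sum_distrib_left[symmetric] tot)
  qed
  then obtain u0 where u0: "u0 < k" "k * W u0 \<le> (\<Sum>i\<in>A. w i)" by auto
  define g where "g = f(e := u0)"
  have "(\<Sum>i\<in>{i \<in> insert e A. g i = u}. w i) = (if u = u0 then w e else 0) + W u" for u
  proof -
    have "{i \<in> insert e A. g i = u} = (if u = u0 then insert e {i\<in>A. f i = u} else {i\<in>A. f i = u})"
      using insert.hyps by (auto simp: g_def)
    then show ?thesis using insert.hyps by (simp add: W_def)
  qed
  moreover have "k * ((if u = u0 then w e else 0) + W u) \<le> (\<Sum>i\<in>insert e A. w i) + k * b" if "u < k" for u
  proof (cases "u = u0")
    case True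
    have "k * w e \<le> k * b" using insert.prems by (intro mult_le_mono) auto
    with u0 have "k * (w e + W u0) \<le> (\<Sum>i\<in>A. w i) + k * b"
      unfolding add_mult_distrib2 by linarith
    then show ?thesis using True insert.hyps by simp
  next
    case False
    then show ?thesis using le[OF that] insert.hyps by (simp add: W_def)
  qed
  ultimately show ?case
    using f u0 by (intro exI[of _ g]) (auto simp: g_def)
qed auto

text \<open>Here \<open>a\<close> stands for the absolute values of the entries and \<open>M\<close>
  for the maximal norm of a restriction to \<open>q\<close> entries. The bound is stated for
  arbitrary vectors, hence homogeneously, so that it can be applied to pieces of \<open>x\<close>
  and \<open>y\<close>. Rows and columns have separate index types so that the roles can be
  exchanged.\<close>

locale sparse_bilinear_bound =
  fixes X :: "'i set" and Y :: "'j set" and a :: "'i \<Rightarrow> 'j \<Rightarrow> real" and q :: nat and M :: real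
  assumes fin [simp, intro]: "finite X" "finite Y"
    and nonneg: "a i j \<ge> 0" and q: "q \<ge> 1" and M: "M \<ge> 0"
    and bilinear: "I \<subseteq> X \<times> Y \<Longrightarrow> card I \<le> q \<Longrightarrow>
      (\<Sum>(i, j)\<in>I. a i j * x i * y j) \<le> M * (L2_set x X * L2_set y Y)"
begin

text \<open>Removing \<open>q\<close> entries at a time costs one copy of the basic bound each; at
  most \<open>1 + card I / q\<close> copies are used.\<close>

lemma bilinear_any:
  assumes "I \<subseteq> X \<times> Y"
  shows "(\<Sum>(i, j)\<in>I. a i j * x i * y j) \<le> M * (1 + card I / q) * (L2_set x X * L2_set y Y)"
  using assms
proof (induction "card I" arbitrary: I rule: less_induct)
  case less
  let ?N = "L2_set x X * L2_set y Y"
  have finI: "finite I" using less.prems finite_subset by blast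
  have N: "M * ?N \<ge> 0" using M by (simp add: L2_set_nonneg)
  show ?case
  proof (cases "card I \<le> q")
    case True
    have "M * ?N * 1 \<le> M * ?N * (1 + card I / q)"
      using N by (intro mult_left_mono) auto
    then show ?thesis using bilinear[OF less.prems True, of x y] by (simp add: mult_ac)
  next
    case False
    then obtain I' where I': "I' \<subseteq> I" "card I' = q"
      using obtain_subset_with_card_n[of q I] by auto
    have card: "card (I - I') = card I - q"
      using I' finI by (simp add: card_Diff_subset finite_subset)
    have "(\<Sum>(i, j)\<in>I. a i j * x i * y j) =
      (\<Sum>(i, j)\<in>I - I'. a i j * x i * y j) + (\<Sum>(i, j)\<in>I'. a i j * x i * y j)"
      using I' finI by (rule_tac sum.subset_diff)
    also have "\<dots> \<le> M * (1 + card (I - I') / q) * ?N + M * ?N"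
      using False q I' less.prems card by (intro add_mono less.hyps bilinear) auto
    also have "card (I - I') / q = card I / q - 1"
      using card False q by (simp add: of_nat_diff field_simps)
    finally show ?thesis by (simp add: algebra_simps)
  qed
qed

text \<open>Rows and columns are split into \<open>k\<close> classes, weighted by their numbers of
  entries in \<open>J\<close>, so that each class meets at most \<open>(k + 1) * q\<close> entries.
  The blocks \<open>P u v\<close> are estimated separately and summed as in the Schur test.\<close>

lemma sparsification:
  assumes J: "J \<subseteq> X \<times> Y"
    and rows: "\<And>i. card {j. (i, j) \<in> J} \<le> q" and cols: "\<And>j. card {i. (i, j) \<in> J} \<le> q"
    and k: "k \<ge> 1" "card J \<le> k\<^sup>2 * q"
    and x: "L2_set x X \<le> 1" and y: "L2_set y Y \<le> 1"
  shows "(\<Sum>(i, j)\<in>J. a i j * x i * y j) \<le> 3 * k * M"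
proof -
  have finJ: "finite J" using J finite_subset by blast
  have fin_row: "finite {j. (i, j) \<in> J}" for i by (rule finite_subset[of _ Y]) (use J in auto)
  have fin_col: "finite {i. (i, j) \<in> J}" for j by (rule finite_subset[of _ X]) (use J in auto)
  have card_rows: "(\<Sum>i\<in>X'. card {j. (i, j) \<in> J}) = card {e\<in>J. fst e \<in> X'}" if "finite X'" for X'
  proof -
    have "{e\<in>J. fst e \<in> X'} = Sigma X' (\<lambda>i. {j. (i, j) \<in> J})" by auto
    then show ?thesis using that fin_row by simp
  qed
  have card_cols: "(\<Sum>j\<in>Y'. card {i. (i, j) \<in> J}) = card {e\<in>J. snd e \<in> Y'}" if "finite Y'" for Y'
  proof -
    have "{e\<in>J. snd e \<in> Y'} = prod.swap ` Sigma Y' (\<lambda>j. {i. (i, j) \<in> J})" by force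
    then show ?thesis using that fin_col by (simp add: card_image)
  qed
  have "{e\<in>J. fst e \<in> X} = J" "{e\<in>J. snd e \<in> Y} = J" using J by auto
  then have tot: "(\<Sum>i\<in>X. card {j. (i, j) \<in> J}) = card J" "(\<Sum>j\<in>Y. card {i. (i, j) \<in> J}) = card J"
    using card_rows[of X] card_cols[of Y] by auto
  have cancel: "c \<le> (k + 1) * q" if "k * c \<le> card J + k * q" for c
  proof -
    have "k * c \<le> k * ((k + 1) * q)" using that k by (simp add: power2_eq_square algebra_simps)
    then show ?thesis using k by simp
  qed
  have "\<exists>f. (\<forall>i\<in>X. f i < k) \<and>
      (\<forall>u<k. k * (\<Sum>i\<in>{i\<in>X. f i = u}. card {j. (i, j) \<in> J}) \<le> card J + k * q)"
    using balanced_partition[of X "\<lambda>i. card {j. (i, j) \<in> J}" q k] rows k by (simp add: tot)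
  then obtain f where f: "\<And>i. i \<in> X \<Longrightarrow> f i < k"
    and fw: "\<And>u. u < k \<Longrightarrow> k * (\<Sum>i\<in>{i\<in>X. f i = u}. card {j. (i, j) \<in> J}) \<le> card J + k * q"
    by blast
  have fJ: "card {e\<in>J. fst e \<in> {i\<in>X. f i = u}} \<le> (k + 1) * q" if "u < k" for u
    using cancel[OF fw[OF that]] by (subst card_rows[symmetric]) auto
  have "\<exists>g. (\<forall>j\<in>Y. g j < k) \<and>
      (\<forall>v<k. k * (\<Sum>j\<in>{j\<in>Y. g j = v}. card {i. (i, j) \<in> J}) \<le> card J + k * q)"
    using balanced_partition[of Y "\<lambda>j. card {i. (i, j) \<in> J}" q k] cols k by (simp add: tot)
  then obtain g where g: "\<And>j. j \<in> Y \<Longrightarrow> g j < k"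
    and gw: "\<And>v. v < k \<Longrightarrow> k * (\<Sum>j\<in>{j\<in>Y. g j = v}. card {i. (i, j) \<in> J}) \<le> card J + k * q"
    by blast
  have gJ: "card {e\<in>J. snd e \<in> {j\<in>Y. g j = v}} \<le> (k + 1) * q" if "v < k" for v
    using cancel[OF gw[OF that]] by (subst card_cols[symmetric]) auto
  define P where "P u v = {e\<in>J. f (fst e) = u \<and> g (snd e) = v}" for u v
  define \<alpha> where "\<alpha> u = L2_set (\<lambda>i. if f i = u then x i else 0) X" for u
  define \<beta> where "\<beta> v = L2_set (\<lambda>j. if g j = v then y j else 0) Y" for v
  have finP: "finite (P u v)" for u v using finJ by (simp add: P_def)
  have Jsum: "(\<Sum>e\<in>J. h e) = (\<Sum>u<k. \<Sum>v<k. \<Sum>e\<in>P u v. h e)" for h :: "'i \<times> 'j \<Rightarrow> real"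
  proof -
    have "(\<Sum>e\<in>J. h e) = (\<Sum>z\<in>{..<k}\<times>{..<k}. \<Sum>e\<in>{e\<in>J. (f (fst e), g (snd e)) = z}. h e)"
      by (rule sum.group[symmetric]) (use finJ J f g in auto)
    then show ?thesis by (simp add: sum.cartesian_product P_def split_def prod_eq_iff)
  qed
  have \<alpha>1: "(\<Sum>u<k. (\<alpha> u)\<^sup>2) \<le> 1"
  proof -
    have "(\<Sum>u<k. (\<alpha> u)\<^sup>2) = (\<Sum>i\<in>X. \<Sum>u<k. (if f i = u then x i else 0)\<^sup>2)"
      unfolding \<alpha>_def L2_set_def by (subst sum.swap) (simp add: sum_nonneg)
    also have "\<dots> = (\<Sum>i\<in>X. (x i)\<^sup>2)"
      using f by (intro sum.cong) (auto simp: if_distrib[of "\<lambda>t. t\<^sup>2"] cong: if_cong)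
    also have "\<dots> \<le> 1" using x by (simp add: L2_set_def)
    finally show ?thesis .
  qed
  have \<beta>1: "(\<Sum>v<k. (\<beta> v)\<^sup>2) \<le> 1"
  proof -
    have "(\<Sum>v<k. (\<beta> v)\<^sup>2) = (\<Sum>j\<in>Y. \<Sum>v<k. (if g j = v then y j else 0)\<^sup>2)"
      unfolding \<beta>_def L2_set_def by (subst sum.swap) (simp add: sum_nonneg)
    also have "\<dots> = (\<Sum>j\<in>Y. (y j)\<^sup>2)"
      using g by (intro sum.cong) (auto simp: if_distrib[of "\<lambda>t. t\<^sup>2"] cong: if_cong)
    also have "\<dots> \<le> 1" using y by (simp add: L2_set_def)
    finally show ?thesis .
  qed
  \<comment> \<open>The ones add up to \<open>k\<close>; the blocks of one row class hold at most
    \<open>(k + 1) * q\<close> entries together.\<close>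
  have R: "(\<Sum>v<k. 1 + card (P u v) / q) \<le> 2 * real k + 1" if "u < k" for u
  proof -
    have "(\<Sum>v<k. card (P u v)) = card (\<Union>v<k. P u v)"
      using finP by (subst card_UN_disjoint) (auto simp: P_def)
    also have "(\<Union>v<k. P u v) = {e\<in>J. fst e \<in> {i\<in>X. f i = u}}" using J g by (auto simp: P_def)
    finally have "(\<Sum>v<k. card (P u v)) \<le> (k + 1) * q" using fJ[OF that] by simp
    then have "(\<Sum>v<k. real (card (P u v))) \<le> (k + 1) * q" by (metis of_nat_le_iff of_nat_sum)
    then have "(\<Sum>v<k. real (card (P u v))) / q \<le> k + 1" using q by (simp add: field_simps)
    then show ?thesis by (simp add: sum.distrib sum_divide_distrib)
  qed
  have C: "(\<Sum>u<k. 1 + card (P u v) / q) \<le> 2 * real k + 1" if "v < k" for v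
  proof -
    have "(\<Sum>u<k. card (P u v)) = card (\<Union>u<k. P u v)"
      using finP by (subst card_UN_disjoint) (auto simp: P_def)
    also have "(\<Union>u<k. P u v) = {e\<in>J. snd e \<in> {j\<in>Y. g j = v}}" using J f by (auto simp: P_def)
    finally have "(\<Sum>u<k. card (P u v)) \<le> (k + 1) * q" using gJ[OF that] by simp
    then have "(\<Sum>u<k. real (card (P u v))) \<le> (k + 1) * q" by (metis of_nat_le_iff of_nat_sum)
    then have "(\<Sum>u<k. real (card (P u v))) / q \<le> k + 1" using q by (simp add: field_simps)
    then show ?thesis by (simp add: sum.distrib sum_divide_distrib)
  qed
  \<comment> \<open>On the block, \<open>x\<close> and \<open>y\<close> may be cut down to their
    classes, which replaces their norms by \<open>\<alpha> u\<close> and \<open>\<beta> v\<close>.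
    The inequality between geometric and arithmetic means then separates these two, so that one can
    be summed along rows and the other along columns.\<close>
  have piece: "(\<Sum>(i, j)\<in>P u v. a i j * x i * y j)
      \<le> M / 2 * ((\<alpha> u)\<^sup>2 * (1 + card (P u v) / q) + (\<beta> v)\<^sup>2 * (1 + card (P u v) / q))" for u v
  proof -
    have "(\<Sum>(i, j)\<in>P u v. a i j * x i * y j)
        = (\<Sum>(i, j)\<in>P u v. a i j * (if f i = u then x i else 0) * (if g j = v then y j else 0))"
      by (intro sum.cong) (auto simp: P_def)
    also have "\<dots> \<le> M * (1 + card (P u v) / q) * (\<alpha> u * \<beta> v)"
      unfolding \<alpha>_def \<beta>_def by (rule bilinear_any) (use J in \<open>auto simp: P_def\<close>)
    also have "\<dots> \<le> M * (1 + card (P u v) / q) * (((\<alpha> u)\<^sup>2 + (\<beta> v)\<^sup>2) / 2)"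
      using M sum_squares_bound[of "\<alpha> u" "\<beta> v"] by (intro mult_left_mono) auto
    finally show ?thesis by (simp add: field_simps)
  qed
  have "(\<Sum>(i, j)\<in>J. a i j * x i * y j) = (\<Sum>u<k. \<Sum>v<k. \<Sum>(i, j)\<in>P u v. a i j * x i * y j)"
    by (rule Jsum)
  also have "\<dots> \<le> (\<Sum>u<k. \<Sum>v<k. M / 2 * ((\<alpha> u)\<^sup>2 * (1 + card (P u v) / q) + (\<beta> v)\<^sup>2 * (1 + card (P u v) / q)))"
    by (intro sum_mono piece)
  also have "\<dots> = M / 2 * ((\<Sum>u<k. (\<alpha> u)\<^sup>2 * (\<Sum>v<k. 1 + card (P u v) / q)) +
      (\<Sum>v<k. (\<beta> v)\<^sup>2 * (\<Sum>u<k. 1 + card (P u v) / q)))"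
  proof -
    have "(\<Sum>u<k. \<Sum>v<k. (\<beta> v)\<^sup>2 * (1 + card (P u v) / q)) = (\<Sum>v<k. (\<beta> v)\<^sup>2 * (\<Sum>u<k. 1 + card (P u v) / q))"
      by (subst sum.swap) (simp add: sum_distrib_left)
    then show ?thesis
      by (simp only: sum_distrib_left[symmetric] sum.distrib)
  qed
  also have "\<dots> \<le> M / 2 * ((\<Sum>u<k. (\<alpha> u)\<^sup>2 * (2 * real k + 1)) + (\<Sum>v<k. (\<beta> v)\<^sup>2 * (2 * real k + 1)))"
    using M R C by (intro mult_left_mono add_mono sum_mono) auto
  also have "\<dots> \<le> M / 2 * (1 * (2 * real k + 1) + 1 * (2 * real k + 1))"
    unfolding sum_distrib_right[symmetric]
    using M by (intro mult_left_mono add_mono mult_right_mono[OF \<alpha>1] mult_right_mono[OF \<beta>1]) simp_all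
  also have "\<dots> = M * (2 * real k + 1)" by (simp add: algebra_simps)
  also have "\<dots> \<le> M * (3 * k)" using M k by (intro mult_left_mono) auto
  finally show ?thesis by (simp add: mult_ac)
qed

section \<open>Heavy entries and their number in each row and column\<close>

definition heavy :: "('i \<times> 'j) set" where
  "heavy = {(i, j) \<in> X \<times> Y. M < a i j * sqrt q}"

lemma finite_heavy: "finite heavy"
  by (rule finite_subset[of _ "X \<times> Y"]) (auto simp: heavy_def)

text \<open>With \<open>q\<close> heavy entries in row \<open>i\<close>, the unit vector at
  \<open>i\<close> and the indicator of their columns, of norm \<open>sqrt q\<close>, would give a
  sum above \<open>q * (M / sqrt q) = M * sqrt q\<close>, against the assumed bound.\<close>

lemma card_heavy_row: "card {j. (i, j) \<in> heavy} \<le> q"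
proof (rule ccontr)
  assume "\<not> ?thesis"
  then obtain S where S: "S \<subseteq> {j. (i, j) \<in> heavy}" "card S = q"
    using obtain_subset_with_card_n[of q "{j. (i, j) \<in> heavy}"] by auto
  have "S \<noteq> {}" using S q by auto
  then have i: "i \<in> X" and SY: "S \<subseteq> Y" using S by (auto simp: heavy_def)
  then have finS: "finite S" using finite_subset by blast
  have X: "L2_set (\<lambda>i'. if i' = i then 1 else 0) X = 1"
    using i by (simp add: L2_set_def if_distrib[of "\<lambda>t. t\<^sup>2"] cong: if_cong)
  have Y: "L2_set (\<lambda>j. if j \<in> S then 1 else 0) Y = sqrt q"
    using SY S by (simp add: L2_set_def if_distrib[of "\<lambda>t. t\<^sup>2"] sum.If_cases Int_absorb1 cong: if_cong)
  have "M * q = (\<Sum>j\<in>S. M)" using S by simp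
  also have "\<dots> < (\<Sum>j\<in>S. a i j * sqrt q)"
    using S finS \<open>S \<noteq> {}\<close> by (intro sum_strict_mono) (auto simp: heavy_def)
  also have "\<dots> = sqrt q * (\<Sum>(i', j)\<in>{i} \<times> S. a i' j * (if i' = i then 1 else 0) * (if j \<in> S then 1 else 0))"
    by (simp add: sum.cartesian_product[symmetric] sum_distrib_left mult_ac)
  also have "\<dots> \<le> sqrt q * (M * (1 * sqrt q))"
    using i SY S bilinear[of "{i} \<times> S" "\<lambda>i'. if i' = i then 1 else 0" "\<lambda>j. if j \<in> S then 1 else 0"]
    unfolding X Y by (intro mult_left_mono) (auto simp: card_cartesian_product)
  also have "\<dots> = M * q" by simp
  finally show False by simp
qed

text \<open>Exchanging rows and columns turns the count of heavy entries per row into the count per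
  column.\<close>

lemma transposed: "sparse_bilinear_bound Y X (\<lambda>j i. a i j) q M"
proof
  fix I x y assume I: "I \<subseteq> Y \<times> X" "card I \<le> q"
  have "(\<Sum>(j, i)\<in>I. a i j * x j * y i) = (\<Sum>(i, j)\<in>prod.swap ` I. a i j * y i * x j)"
    by (subst sum.reindex) (auto simp: split_def mult_ac intro!: sum.cong)
  also have "\<dots> \<le> M * (L2_set y X * L2_set x Y)"
    using I by (intro bilinear) (auto simp: card_image)
  finally show "(\<Sum>(j, i)\<in>I. a i j * x j * y i) \<le> M * (L2_set x Y * L2_set y X)"
    by (simp add: mult_ac)
qed (use nonneg q M in auto)

lemma card_heavy_col: "card {i. (i, j) \<in> heavy} \<le> q"
proof -
  interpret T: sparse_bilinear_bound Y X "\<lambda>j i. a i j" q M by (rule transposed)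
  have "{i. (i, j) \<in> heavy} = {i. (j, i) \<in> T.heavy}" by (auto simp: heavy_def T.heavy_def)
  then show ?thesis using T.card_heavy_row by simp
qed

section \<open>Level sets of the terms for a fixed pair of vectors\<close>

context
  fixes x :: "'i \<Rightarrow> real" and y :: "'j \<Rightarrow> real"
  assumes x: "L2_set x X \<le> 1" "\<And>i. x i \<ge> 0" and y: "L2_set y Y \<le> 1" "\<And>j. y j \<ge> 0"
begin

text \<open>For nonnegative vectors these are the absolute values of the terms of the bilinear form;
  signed vectors are replaced by their absolute values, which have the same norm.\<close>

abbreviation c :: "'i \<times> 'j \<Rightarrow> real" where
  "c e \<equiv> a (fst e) (snd e) * x (fst e) * y (snd e)"

lemma c_nonneg: "c e \<ge> 0"
  using nonneg x y by simp

lemma sum_c_le: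
  assumes "I \<subseteq> X \<times> Y" "card I \<le> q"
  shows "(\<Sum>e\<in>I. c e) \<le> M"
proof -
  have "(\<Sum>e\<in>I. c e) \<le> M * (L2_set x X * L2_set y Y)"
    using bilinear[OF assms, of x y] by (simp add: split_def)
  also have "\<dots> \<le> M * (1 * 1)"
    using x y M by (intro mult_left_mono mult_mono) (auto simp: L2_set_nonneg)
  finally show ?thesis by simp
qed

text \<open>If \<open>N\<close> heavy terms exceed \<open>v\<close>, their sum is at least
  \<open>N * v\<close>. For \<open>N \<le> q\<close> it is at most \<open>M\<close>, and
  \<open>v * q \<le> M\<close> supplies the other factor. For larger \<open>N\<close> it is at most
  \<open>6 * sqrt (N / q) * M\<close> by sparsification; squaring and cancelling one factor
  \<open>N\<close> gives the bound.\<close>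

lemma heavy_weak_L2:
  fixes v :: real
  assumes v: "0 \<le> v" "v * q \<le> M"
  shows "card {e\<in>heavy. v < c e} * v\<^sup>2 * q \<le> 36 * M\<^sup>2"
proof -
  define J where "J = {e\<in>heavy. v < c e}"
  define N where "N = card J"
  have J: "J \<subseteq> X \<times> Y" by (auto simp: J_def heavy_def)
  have finJ: "finite J" using finite_heavy by (simp add: J_def)
  have "real N * v = (\<Sum>e\<in>J. v)" by (simp add: N_def)
  also have "\<dots> \<le> (\<Sum>e\<in>J. c e)" by (intro sum_mono) (auto simp: J_def)
  finally have Nv: "N * v \<le> (\<Sum>e\<in>J. c e)" .
  have "N * v\<^sup>2 * q \<le> 36 * M\<^sup>2"
  proof (cases "N \<le> q")
    case True
    then have "N * v \<le> M" using Nv sum_c_le[OF J] by (simp add: N_def)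
    then have "(N * v) * (v * q) \<le> M * M" using v M by (intro mult_mono) auto
    also have "\<dots> \<le> 36 * M\<^sup>2" by (simp add: power2_eq_square)
    finally show ?thesis by (simp add: power2_eq_square mult_ac)
  next
    case False
    define r where "r = sqrt (N / q)"
    have r: "r \<ge> 1" "r\<^sup>2 = N / q" using False q by (auto simp: r_def)
    \<comment> \<open>The least integer \<open>k\<close> with \<open>N \<le> k\<^sup>2 * q\<close>;
      it is at most \<open>2 * r\<close> because \<open>r \<ge> 1\<close>.\<close>
    define k where "k = nat \<lceil>r\<rceil>"
    have k: "k \<ge> 1" "r \<le> k" "k \<le> r + 1" using r unfolding k_def by linarith+
    have "r\<^sup>2 \<le> (real k)\<^sup>2" using k r by (intro power_mono) auto
    then have "real N \<le> (real k)\<^sup>2 * q" using r q by (simp add: field_simps)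
    then have "N \<le> k\<^sup>2 * q" by (metis of_nat_le_iff of_nat_mult of_nat_power)
    moreover have "card {j. (i, j) \<in> J} \<le> q" for i
    proof (rule order_trans[OF card_mono card_heavy_row])
      show "finite {j. (i, j) \<in> heavy}" by (rule finite_subset[of _ Y]) (auto simp: heavy_def)
    qed (auto simp: J_def)
    moreover have "card {i. (i, j) \<in> J} \<le> q" for j
    proof (rule order_trans[OF card_mono card_heavy_col])
      show "finite {i. (i, j) \<in> heavy}" by (rule finite_subset[of _ X]) (auto simp: heavy_def)
    qed (auto simp: J_def)
    ultimately have "(\<Sum>e\<in>J. c e) \<le> 3 * k * M"
      using sparsification[OF J _ _ k(1) _ x(1) y(1)] by (simp add: split_def N_def)
    also have "\<dots> \<le> 3 * (2 * r) * M" using k r M by (intro mult_right_mono mult_left_mono) auto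
    finally have "N * v \<le> 6 * r * M" using Nv by simp
    then have "(N * v)\<^sup>2 \<le> (6 * r * M)\<^sup>2" using v by (intro power_mono) auto
    also have "\<dots> = 36 * (N / q) * M\<^sup>2" using r by (simp add: power_mult_distrib)
    finally have "N * (N * v\<^sup>2 * q) \<le> N * (36 * M\<^sup>2)"
      using q by (simp add: field_simps power2_eq_square)
    then show ?thesis using False by simp
  qed
  then show ?thesis by (simp add: N_def J_def)
qed

text \<open>Terms between \<open>v / 2\<close> and \<open>v\<close> have squares at most
  \<open>4 * (v / 2)\<^sup>2\<close>, so the weak bound at level \<open>v / 2\<close> controls them
  with the constant \<open>144 = 4 * 36\<close>.\<close>

lemma heavy_square_sum_step:
  fixes v :: real
  assumes v: "0 \<le> v" "v * q \<le> M"
  shows "q * (\<Sum>e\<in>{e\<in>heavy. c e \<le> v}. (c e)\<^sup>2)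
    \<le> q * (\<Sum>e\<in>{e\<in>heavy. c e \<le> v / 2}. (c e)\<^sup>2) + 144 * M\<^sup>2"
proof -
  define J where "J = {e\<in>heavy. v / 2 < c e \<and> c e \<le> v}"
  have fin: "finite J" using finite_heavy by (simp add: J_def)
  have split: "{e\<in>heavy. c e \<le> v} = {e\<in>heavy. c e \<le> v / 2} \<union> J"
    using v by (auto simp: J_def)
  have "(\<Sum>e\<in>J. (c e)\<^sup>2) \<le> real (card J) * v\<^sup>2"
    by (intro sum_bounded_above power_mono c_nonneg) (auto simp: J_def)
  also have "\<dots> \<le> card {e\<in>heavy. v / 2 < c e} * v\<^sup>2"
    using finite_heavy by (auto simp: J_def intro!: mult_right_mono card_mono)
  finally have "q * (\<Sum>e\<in>J. (c e)\<^sup>2) \<le> 4 * (card {e\<in>heavy. v / 2 < c e} * (v / 2)\<^sup>2 * q)"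
    by (subst mult.commute) (simp add: mult_right_mono power2_eq_square)
  also have "\<dots> \<le> 4 * (36 * M\<^sup>2)"
    using v M by (intro mult_left_mono heavy_weak_L2) auto
  finally have "q * (\<Sum>e\<in>J. (c e)\<^sup>2) \<le> 144 * M\<^sup>2" by simp
  moreover have "(\<Sum>e\<in>{e\<in>heavy. c e \<le> v}. (c e)\<^sup>2)
      = (\<Sum>e\<in>{e\<in>heavy. c e \<le> v / 2}. (c e)\<^sup>2) + (\<Sum>e\<in>J. (c e)\<^sup>2)"
    unfolding split using finite_heavy fin by (intro sum.union_disjoint) (auto simp: J_def)
  ultimately show ?thesis by (simp add: distrib_left)
qed

text \<open>The level is halved \<open>L\<close> times, starting from \<open>M / q\<close>, the
  highest level at which the weak bound applies.\<close>

lemma heavy_square_sum: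
  "q * (\<Sum>e\<in>{e\<in>heavy. c e \<le> M / q}. (c e)\<^sup>2)
    \<le> q * (\<Sum>e\<in>{e\<in>heavy. c e \<le> M / q / 2 ^ L}. (c e)\<^sup>2) + 144 * L * M\<^sup>2"
proof (induction L)
  case (Suc L)
  have "M / q / 2 ^ L * q \<le> M"
    using M q mult_left_mono[of 1 "2 ^ L" M] by (simp add: field_simps)
  with heavy_square_sum_step[of "M / q / 2 ^ L"] M Suc show ?case
    by (simp add: field_simps)
qed simp

lemma entry_le:
  assumes "e \<in> X \<times> Y"
  shows "a (fst e) (snd e) \<le> M"
proof -
  obtain i j where e: "e = (i, j)" "i \<in> X" "j \<in> Y" using assms by auto
  have "L2_set (\<lambda>i'. if i' = i then 1 else 0) X = 1" "L2_set (\<lambda>j'. if j' = j then 1 else 0) Y = 1"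
    using e by (simp_all add: L2_set_def if_distrib[of "\<lambda>t. t\<^sup>2"] cong: if_cong)
  then show ?thesis
    using bilinear[of "{e}" "\<lambda>i'. if i' = i then 1 else 0" "\<lambda>j'. if j' = j then 1 else 0"] e q by simp
qed

text \<open>Since \<open>a i j \<le> M\<close>, each term is at most \<open>M / 2\<close> times the
  sum of the squares of \<open>x i\<close> and \<open>y j\<close>. By the row and column counts,
  every such square occurs at most \<open>q\<close> times. This crude bound handles the terms below
  the last dyadic level.\<close>

lemma sum_heavy: "(\<Sum>e\<in>heavy. c e) \<le> M * q"
proof -
  have fin_row: "finite {j. (i, j) \<in> heavy}" for i by (rule finite_subset[of _ Y]) (auto simp: heavy_def)
  have fin_col: "finite {i. (i, j) \<in> heavy}" for j by (rule finite_subset[of _ X]) (auto simp: heavy_def)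
  have rows: "(\<Sum>e\<in>heavy. (x (fst e))\<^sup>2) \<le> q"
  proof -
    have "heavy = Sigma X (\<lambda>i. {j. (i, j) \<in> heavy})" by (auto simp: heavy_def)
    then have "(\<Sum>e\<in>heavy. (x (fst e))\<^sup>2) = (\<Sum>e\<in>Sigma X (\<lambda>i. {j. (i, j) \<in> heavy}). (x (fst e))\<^sup>2)"
      by simp
    also have "\<dots> = (\<Sum>i\<in>X. card {j. (i, j) \<in> heavy} * (x i)\<^sup>2)"
      using fin_row by (subst sum.Sigma[symmetric, of X _ "\<lambda>i j. (x i)\<^sup>2", unfolded split_def]) auto
    also have "\<dots> \<le> (\<Sum>i\<in>X. real q * (x i)\<^sup>2)"
      using card_heavy_row by (intro sum_mono mult_right_mono) auto
    also have "\<dots> = real q * (\<Sum>i\<in>X. (x i)\<^sup>2)" by (simp add: sum_distrib_left)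
    also have "\<dots> \<le> real q * 1" using x by (intro mult_left_mono) (auto simp: L2_set_def)
    finally show ?thesis by simp
  qed
  have cols: "(\<Sum>e\<in>heavy. (y (snd e))\<^sup>2) \<le> q"
  proof -
    have "(\<Sum>e\<in>heavy. (y (snd e))\<^sup>2) = (\<Sum>e\<in>Sigma Y (\<lambda>j. {i. (i, j) \<in> heavy}). (y (fst e))\<^sup>2)"
      by (rule sum.reindex_bij_witness[of _ prod.swap prod.swap]) (auto simp: heavy_def)
    also have "\<dots> = (\<Sum>j\<in>Y. card {i. (i, j) \<in> heavy} * (y j)\<^sup>2)"
      using fin_col by (subst sum.Sigma[symmetric, of Y _ "\<lambda>j i. (y j)\<^sup>2", unfolded split_def]) auto
    also have "\<dots> \<le> (\<Sum>j\<in>Y. real q * (y j)\<^sup>2)"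
      using card_heavy_col by (intro sum_mono mult_right_mono) auto
    also have "\<dots> = real q * (\<Sum>j\<in>Y. (y j)\<^sup>2)" by (simp add: sum_distrib_left)
    also have "\<dots> \<le> real q * 1" using y by (intro mult_left_mono) (auto simp: L2_set_def)
    finally show ?thesis by simp
  qed
  have "(\<Sum>e\<in>heavy. c e) \<le> (\<Sum>e\<in>heavy. M / 2 * ((x (fst e))\<^sup>2 + (y (snd e))\<^sup>2))"
  proof (rule sum_mono)
    fix e assume "e \<in> heavy"
    then have "c e \<le> M * (x (fst e) * y (snd e))"
      using entry_le[of e] x y by (auto simp: heavy_def mult.assoc intro!: mult_right_mono)
    also have "\<dots> \<le> M * (((x (fst e))\<^sup>2 + (y (snd e))\<^sup>2) / 2)"
      using M sum_squares_bound[of "x (fst e)" "y (snd e)"] by (intro mult_left_mono) auto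
    finally show "c e \<le> M / 2 * ((x (fst e))\<^sup>2 + (y (snd e))\<^sup>2)" by simp
  qed
  also have "\<dots> = M / 2 * ((\<Sum>e\<in>heavy. (x (fst e))\<^sup>2) + (\<Sum>e\<in>heavy. (y (snd e))\<^sup>2))"
    by (simp only: sum_distrib_left[symmetric] sum.distrib)
  also have "\<dots> \<le> M / 2 * (real q + real q)"
    using M rows cols by (intro mult_left_mono add_mono) auto
  finally show ?thesis by simp
qed

text \<open>A light entry has square at most \<open>M\<^sup>2 / q\<close>, and the sum of the
  squares of \<open>x i * y j\<close> over the whole grid is a product of two squared norms.\<close>

lemma light_square_sum: "q * (\<Sum>e\<in>X \<times> Y - heavy. (c e)\<^sup>2) \<le> M\<^sup>2"
proof -
  have "q * (\<Sum>e\<in>X \<times> Y - heavy. (c e)\<^sup>2) \<le> q * (\<Sum>e\<in>X \<times> Y - heavy. M\<^sup>2 / q * ((x (fst e))\<^sup>2 * (y (snd e))\<^sup>2))"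
  proof (intro mult_left_mono sum_mono)
    fix e assume e: "e \<in> X \<times> Y - heavy"
    then have "(a (fst e) (snd e) * sqrt q)\<^sup>2 \<le> M\<^sup>2"
      using nonneg by (intro power_mono) (auto simp: heavy_def)
    then have "(a (fst e) (snd e))\<^sup>2 \<le> M\<^sup>2 / q"
      using q by (simp add: power_mult_distrib field_simps)
    then have "(a (fst e) (snd e))\<^sup>2 * ((x (fst e))\<^sup>2 * (y (snd e))\<^sup>2) \<le> M\<^sup>2 / q * ((x (fst e))\<^sup>2 * (y (snd e))\<^sup>2)"
      by (intro mult_right_mono) auto
    then show "(c e)\<^sup>2 \<le> M\<^sup>2 / q * ((x (fst e))\<^sup>2 * (y (snd e))\<^sup>2)"
      by (simp add: power_mult_distrib mult.assoc)
  qed simp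
  also have "\<dots> = M\<^sup>2 * (\<Sum>e\<in>X \<times> Y - heavy. (x (fst e))\<^sup>2 * (y (snd e))\<^sup>2)"
    using q by (simp only: sum_distrib_left[symmetric]) simp
  also have "\<dots> \<le> M\<^sup>2 * (\<Sum>e\<in>X \<times> Y. (x (fst e))\<^sup>2 * (y (snd e))\<^sup>2)"
    by (intro mult_left_mono sum_mono2) auto
  also have "(\<Sum>e\<in>X \<times> Y. (x (fst e))\<^sup>2 * (y (snd e))\<^sup>2) = (\<Sum>i\<in>X. (x i)\<^sup>2) * (\<Sum>j\<in>Y. (y j)\<^sup>2)"
    by (simp add: sum_product sum.cartesian_product split_def)
  also have "M\<^sup>2 * \<dots> \<le> M\<^sup>2 * (1 * 1)"
    using x y by (intro mult_left_mono mult_mono) (auto simp: L2_set_def sum_nonneg)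
  finally show ?thesis by simp
qed

text \<open>The head \<open>T\<close> consists of the terms above \<open>M / q\<close>. The tail has
  three parts: \<open>L\<close> dyadic levels of heavy terms contribute
  \<open>144 * L * M\<^sup>2\<close>. Heavy terms below them are at most \<open>M / q / q\<close>,
  so their squares are controlled by their sum and contribute \<open>M\<^sup>2\<close>, and the
  light terms another \<open>M\<^sup>2\<close>.\<close>

lemma head_tail_decomposition:
  assumes L: "q \<le> 2 ^ L"
  shows "\<exists>T\<subseteq>X \<times> Y. (\<Sum>e\<in>T. c e) \<le> M \<and> q * (\<Sum>e\<in>X \<times> Y - T. (c e)\<^sup>2) \<le> (2 + 144 * real L) * M\<^sup>2"
proof (intro exI[of _ "{e\<in>X \<times> Y. M / q < c e}"] conjI)
  let ?T = "{e\<in>X \<times> Y. M / q < c e}"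
  have "card ?T \<le> q"
  proof (rule ccontr)
    assume "\<not> ?thesis"
    then obtain S where S: "S \<subseteq> ?T" "card S = q" "finite S"
      using obtain_subset_with_card_n[of q ?T] by auto
    have "S \<noteq> {}" using S q by auto
    have "M = (\<Sum>e\<in>S. M / q)" using S q by simp
    also have "\<dots> < (\<Sum>e\<in>S. c e)" using S \<open>S \<noteq> {}\<close> by (intro sum_strict_mono) auto
    also have "\<dots> \<le> M" using S by (intro sum_c_le) auto
    finally show False by simp
  qed
  then show "(\<Sum>e\<in>?T. c e) \<le> M" by (intro sum_c_le) auto
  have "q * (\<Sum>e\<in>{e\<in>heavy. c e \<le> M / q / 2 ^ L}. (c e)\<^sup>2)
      \<le> q * (\<Sum>e\<in>{e\<in>heavy. c e \<le> M / q / 2 ^ L}. M / q / q * c e)"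
  proof (intro mult_left_mono sum_mono)
    fix e assume e: "e \<in> {e\<in>heavy. c e \<le> M / q / 2 ^ L}"
    have "real q \<le> 2 ^ L" using L by (metis of_nat_le_iff of_nat_numeral of_nat_power)
    then have "M / q / 2 ^ L \<le> M / q / q" using M q by (intro divide_left_mono) auto
    then show "(c e)\<^sup>2 \<le> M / q / q * c e"
      unfolding power2_eq_square using e c_nonneg by (intro mult_right_mono) auto
  qed simp
  also have "\<dots> = M / q * (\<Sum>e\<in>{e\<in>heavy. c e \<le> M / q / 2 ^ L}. c e)"
    using q by (simp only: sum_distrib_left[symmetric]) simp
  also have "\<dots> \<le> M / q * (\<Sum>e\<in>heavy. c e)"
    using finite_heavy M c_nonneg by (intro mult_left_mono sum_mono2) auto
  also have "\<dots> \<le> M / q * (M * q)"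
    using sum_heavy M by (intro mult_left_mono) auto
  also have "\<dots> = M\<^sup>2" using q by (simp add: power2_eq_square)
  finally have "q * (\<Sum>e\<in>{e\<in>heavy. c e \<le> M / q}. (c e)\<^sup>2) \<le> M\<^sup>2 + 144 * L * M\<^sup>2"
    using heavy_square_sum[of L] by linarith
  moreover have "(\<Sum>e\<in>X \<times> Y - ?T. (c e)\<^sup>2)
      \<le> (\<Sum>e\<in>{e\<in>heavy. c e \<le> M / q} \<union> (X \<times> Y - heavy). (c e)\<^sup>2)"
    using finite_heavy by (intro sum_mono2) auto
  moreover have "\<dots> = (\<Sum>e\<in>{e\<in>heavy. c e \<le> M / q}. (c e)\<^sup>2) + (\<Sum>e\<in>X \<times> Y - heavy. (c e)\<^sup>2)"
    using finite_heavy by (intro sum.union_disjoint) auto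
  ultimately have "q * (\<Sum>e\<in>X \<times> Y - ?T. (c e)\<^sup>2) \<le> M\<^sup>2 + 144 * L * M\<^sup>2 + M\<^sup>2"
    using light_square_sum
    by (smt (verit, best) distrib_left mult_left_mono of_nat_0_le_iff)
  then show "q * (\<Sum>e\<in>X \<times> Y - ?T. (c e)\<^sup>2) \<le> (2 + 144 * real L) * M\<^sup>2"
    by (simp add: algebra_simps)
qed auto

end

end

section \<open>Moments of Rademacher sums\<close>

text \<open>The left side is the exponential moment of a random sign, and Hoeffding's lemma on
  \<open>[-1, 1]\<close> gives the exponent \<open>x\<^sup>2 * 2\<^sup>2 / 8\<close>. Negative
  \<open>x\<close> follows by evenness.\<close>

lemma cosh_le_exp_square: "cosh x \<le> exp (x\<^sup>2 / 2)" for x :: real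
proof -
  have *: "cosh x \<le> exp (x\<^sup>2 / 2)" if "x > 0" for x :: real
  proof -
    interpret interval_bounded_random_variable "measure_pmf (pmf_of_set {-1, 1::real})" "\<lambda>x. x" "-1" 1
      by unfold_locales (auto simp: AE_measure_pmf_iff)
    have fin: "finite (set_pmf (pmf_of_set {-1, 1::real}))" by simp
    have "ennreal (cosh x) = ennreal (measure_pmf.expectation (pmf_of_set {-1, 1}) (\<lambda>y. exp (x * y)))"
      by (simp add: integral_pmf_of_set cosh_def)
    also have "\<dots> = nn_integral (measure_pmf (pmf_of_set {-1, 1})) (\<lambda>y. exp (x * y))"
      using integrable_measure_pmf_finite[OF fin] by (intro nn_integral_eq_integral[symmetric]) auto
    also have "\<dots> \<le> ennreal (exp (x\<^sup>2 * (1 - (-1))\<^sup>2 / 8))"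
      by (rule Hoeffdings_lemma_nn_integral_0) (use that in \<open>simp_all add: integral_pmf_of_set\<close>)
    finally show ?thesis by (simp add: ennreal_le_iff)
  qed
  show ?thesis
    using *[of x] *[of "-x"] by (cases x "0::real" rule: linorder_cases) auto
qed

lemma cosh_le_exp_abs: "cosh x \<le> exp \<bar>x\<bar>" for x :: real
  by (cases "x \<ge> 0") (auto simp: cosh_def field_simps)

text \<open>The default value 0 makes \<open>sign_pmf n\<close> the instance for the square
  grid.\<close>

abbreviation sign_vectors :: "'k set \<Rightarrow> ('k \<Rightarrow> real) pmf" where
  "sign_vectors K \<equiv> Pi_pmf K 0 (\<lambda>_. pmf_of_set {-1, 1})"

lemma finite_sign_vectors: "finite K \<Longrightarrow> finite (set_pmf (sign_vectors K))"
  by (rule finite_subset[OF set_Pi_pmf_subset']) auto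

lemma integrable_sign_vectors [simp]:
  "finite K \<Longrightarrow> integrable (measure_pmf (sign_vectors K)) f" for f :: "_ \<Rightarrow> real"
  by (rule integrable_measure_pmf_finite[OF finite_sign_vectors])

lemma exp_moment_signs:
  assumes "finite K"
  shows "measure_pmf.expectation (sign_vectors K) (\<lambda>\<omega>. exp (l * (\<Sum>k\<in>K. c k * \<omega> k)))
    = (\<Prod>k\<in>K. cosh (l * c k))"
proof -
  have "measure_pmf.expectation (sign_vectors K) (\<lambda>\<omega>. exp (l * (\<Sum>k\<in>K. c k * \<omega> k)))
      = measure_pmf.expectation (sign_vectors K) (\<lambda>\<omega>. \<Prod>k\<in>K. exp (l * c k * \<omega> k))"
    using assms by (simp add: exp_sum[symmetric] sum_distrib_left mult_ac)
  also have "\<dots> = (\<Prod>k\<in>K. measure_pmf.expectation (pmf_of_set {-1, 1}) (\<lambda>y. exp (l * c k * y)))"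
    using assms by (intro expectation_prod_Pi_pmf) (auto intro: integrable_measure_pmf_finite)
  also have "\<dots> = (\<Prod>k\<in>K. cosh (l * c k))"
    by (simp add: integral_pmf_of_set cosh_def add.commute)
  finally show ?thesis .
qed

text \<open>Moments are controlled by exponential moments, where each coefficient in the head
  \<open>T\<close> uses \<open>cosh x \<le> exp \<bar>x\<bar>\<close> and each one in the tail the
  subgaussian bound.\<close>

lemma Lp_norm_signs_le:
  fixes p :: real
  assumes K: "finite K" "T \<subseteq> K" and p: "p \<ge> 1" and D: "D \<ge> 0"
    and head: "(\<Sum>k\<in>T. \<bar>c k\<bar>) \<le> D * sqrt p" and tail: "(\<Sum>k\<in>K - T. (c k)\<^sup>2) \<le> D\<^sup>2"
  shows "Lp_norm (sign_vectors K) p (\<lambda>\<omega>. \<Sum>k\<in>K. c k * \<omega> k) \<le> 10 * sqrt p * D"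
proof (cases "D = 0")
  \<comment> \<open>All coefficients vanish here; the parameter \<open>l\<close> below divides by
    \<open>D\<close>.\<close>
  case True
  have finT: "finite T" "finite (K - T)" using K finite_subset by auto
  have "\<forall>k\<in>T. \<bar>c k\<bar> = 0"
    using head True finT by (subst sum_nonneg_eq_0_iff[symmetric]) (auto intro!: antisym sum_nonneg)
  moreover have "\<forall>k\<in>K - T. (c k)\<^sup>2 = 0"
    using tail True finT by (subst sum_nonneg_eq_0_iff[symmetric]) (auto intro!: antisym sum_nonneg)
  ultimately have "\<forall>k\<in>K. c k = 0" by auto
  then show ?thesis using p D by (simp add: Lp_norm_def)
next
  case False
  then have D: "D > 0" using D by simp
  let ?S = "\<lambda>\<omega>. \<Sum>k\<in>K. c k * \<omega> k"
  let ?E = "measure_pmf.expectation (sign_vectors K)"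
  \<comment> \<open>With this value the head contributes \<open>p\<close> and the tail
    \<open>p / 2\<close> to the exponent.\<close>
  define l where "l = sqrt p / D"
  have l: "l > 0" using p D by (simp add: l_def)
  have mgf: "?E (\<lambda>\<omega>. exp (l' * ?S \<omega>)) \<le> exp (3 / 2 * p)" if l': "\<bar>l'\<bar> = l" for l'
  proof -
    have "?E (\<lambda>\<omega>. exp (l' * ?S \<omega>)) = (\<Prod>k\<in>T. cosh (l' * c k)) * (\<Prod>k\<in>K - T. cosh (l' * c k))"
      unfolding exp_moment_signs[OF K(1)] by (subst prod.subset_diff[OF K(2,1)]) simp
    also have "\<dots> \<le> (\<Prod>k\<in>T. exp (l * \<bar>c k\<bar>)) * (\<Prod>k\<in>K - T. exp (l\<^sup>2 * (c k)\<^sup>2 / 2))"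
    proof (intro mult_mono prod_mono conjI)
      fix k
      show "cosh (l' * c k) \<le> exp (l * \<bar>c k\<bar>)"
        using cosh_le_exp_abs[of "l' * c k"] l' by (simp add: abs_mult)
      have "l'\<^sup>2 = l\<^sup>2" using l' by (metis power2_abs)
      then show "cosh (l' * c k) \<le> exp (l\<^sup>2 * (c k)\<^sup>2 / 2)"
        using cosh_le_exp_square[of "l' * c k"] by (simp add: power_mult_distrib)
    qed (auto intro!: prod_nonneg)
    also have "\<dots> = exp (l * (\<Sum>k\<in>T. \<bar>c k\<bar>) + l\<^sup>2 * (\<Sum>k\<in>K - T. (c k)\<^sup>2) / 2)"
      using K finite_subset[OF K(2,1)]
      by (simp add: exp_sum[symmetric] exp_add sum_distrib_left sum_divide_distrib)
    also have "\<dots> \<le> exp (l * (D * sqrt p) + l\<^sup>2 * D\<^sup>2 / 2)"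
      using l head tail by (auto intro!: add_mono divide_right_mono mult_left_mono)
    also have "l * (D * sqrt p) + l\<^sup>2 * D\<^sup>2 / 2 = 3 / 2 * p"
      using D p by (simp add: l_def power_divide field_simps)
    finally show ?thesis .
  qed
  have "?E (\<lambda>\<omega>. \<bar>?S \<omega>\<bar> powr p) \<le> ?E (\<lambda>\<omega>. (p / l) powr p * (exp (l * ?S \<omega>) + exp ((- l) * ?S \<omega>)))"
  proof (intro integral_mono)
    fix \<omega>
    define z where "z = \<bar>?S \<omega>\<bar>"
    \<comment> \<open>This is \<open>u \<le> exp u\<close> at \<open>u = l * z / p\<close>; its
      \<open>p\<close>-th power compares the moment with \<open>exp (l * z)\<close>.\<close>
    have "z \<le> p / l * exp (l * z / p)"
      using exp_ge_add_one_self[of "l * z / p"] l p by (simp add: field_simps)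
    then have "z powr p \<le> (p / l * exp (l * z / p)) powr p"
      using p by (intro powr_mono2) (auto simp: z_def)
    also have "\<dots> = (p / l) powr p * exp (l * z)"
      using p l by (subst powr_mult) (auto simp: exp_powr_real)
    also have "\<dots> \<le> (p / l) powr p * (exp (l * ?S \<omega>) + exp ((- l) * ?S \<omega>))"
      by (intro mult_left_mono) (auto simp: z_def abs_if)
    finally show "\<bar>?S \<omega>\<bar> powr p \<le> (p / l) powr p * (exp (l * ?S \<omega>) + exp ((- l) * ?S \<omega>))"
      unfolding z_def .
  qed (use K in auto)
  also have "\<dots> = (p / l) powr p * (?E (\<lambda>\<omega>. exp (l * ?S \<omega>)) + ?E (\<lambda>\<omega>. exp ((- l) * ?S \<omega>)))"
    using K by (subst Bochner_Integration.integral_add[symmetric]) auto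
  also have "\<dots> \<le> (p / l) powr p * (exp (3 / 2 * p) + exp (3 / 2 * p))"
    using l by (intro mult_left_mono add_mono mgf) auto
  also have "\<dots> = (p / l) powr p * (2 * exp (3 / 2) powr p)"
    using p by (simp add: exp_powr_real)
  \<comment> \<open>The factor 2 from the two exponentials is absorbed into a \<open>p\<close>-th
    power. With \<open>exp (3 / 2) \<le> 5\<close> this leads to the constant 10.\<close>
  also have "\<dots> \<le> (p / l) powr p * (2 powr p * exp (3 / 2) powr p)"
    using p powr_mono[of 1 p 2] by (intro mult_left_mono mult_right_mono) auto
  also have "\<dots> = (p / l * (2 * exp (3 / 2))) powr p"
    using p l by (simp add: powr_mult del: times_divide_eq_left)
  finally have "(?E (\<lambda>\<omega>. \<bar>?S \<omega>\<bar> powr p)) powr (1 / p) \<le> ((p / l * (2 * exp (3 / 2))) powr p) powr (1 / p)"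
    using p by (intro powr_mono2) (auto intro: integral_nonneg_AE)
  also have "\<dots> = p / l * (2 * exp (3 / 2))"
    using p l by (simp add: powr_powr)
  also have "p / l = sqrt p * D"
    using p D by (simp add: l_def field_simps)
  also have "2 * exp (3 / 2 :: real) \<le> 10"
  proof -
    have "exp (3 / 2 :: real) ^ 2 = exp 1 ^ 3" by (simp add: exp_of_nat_mult[symmetric])
    also have "\<dots> \<le> (2.8 :: real) ^ 3" using e_less_272 by (intro power_mono) auto
    also have "\<dots> \<le> 5 ^ 2" by (simp add: power3_eq_cube power2_eq_square)
    finally have "exp (3 / 2 :: real) \<le> 5" by (rule power2_le_imp_le) simp
    then show ?thesis by simp
  qed
  finally show ?thesis
    using p D unfolding Lp_norm_def by (simp add: mult_ac mult_left_mono)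
qed

text \<open>When the signs in \<open>I\<close> match those of the coefficients, the part of the sum
  over \<open>I\<close> equals \<open>\<Sum>k\<in>I. \<bar>c k\<bar>\<close>, and the other signs
  average to zero.\<close>

lemma Lp_norm_signs_ge:
  fixes p :: real
  assumes K: "finite K" "I \<subseteq> K" and p: "p \<ge> 1" "real (card I) \<le> p"
  shows "(\<Sum>k\<in>I. \<bar>c k\<bar>) / 2 \<le> Lp_norm (sign_vectors K) p (\<lambda>\<omega>. \<Sum>k\<in>K. c k * \<omega> k)"
proof (cases "(\<Sum>k\<in>I. \<bar>c k\<bar>) = 0")
  case True
  then show ?thesis by (simp add: Lp_norm_def)
next
  case False
  define b where "b = (\<Sum>k\<in>I. \<bar>c k\<bar>)"
  have b: "b > 0" using False sum_nonneg[of I "\<lambda>k. \<bar>c k\<bar>"] by (simp add: b_def less_le)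
  let ?S = "\<lambda>\<omega>. \<Sum>k\<in>K. c k * \<omega> k"
  let ?E = "measure_pmf.expectation (sign_vectors K)"
  \<comment> \<open>A zero coefficient also gets a genuine sign, so that each constraint has
    probability exactly 1/2.\<close>
  define \<sigma> where "\<sigma> k = (if c k \<ge> 0 then 1 else - 1 :: real)" for k
  have \<sigma>: "\<sigma> k = 1 \<or> \<sigma> k = -1" "c k * \<sigma> k = \<bar>c k\<bar>" for k by (auto simp: \<sigma>_def)
  \<comment> \<open>The product \<open>?H\<close> of these factors is the indicator of the event of
    matching signs; each factor depends on one coordinate, so expectations factorise.\<close>
  define h where "h k v = (if k \<in> I then of_bool (v = \<sigma> k) else 1 :: real)" for k v
  let ?H = "\<lambda>\<omega>. \<Prod>k\<in>K. h k (\<omega> k)"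
  have half: "(\<Prod>k\<in>J. if k \<in> I then 1 / 2 else 1 :: real) = (1 / 2) ^ card (I \<inter> J)" if "finite J" for J
    using that by (simp add: prod.If_cases Int_commute)
  have EH: "?E ?H = (1 / 2) ^ card I"
  proof -
    have "?E ?H = (\<Prod>k\<in>K. measure_pmf.expectation (pmf_of_set {-1, 1}) (h k))"
      using K by (intro expectation_prod_Pi_pmf) (auto intro: integrable_measure_pmf_finite simp: h_def)
    also have "\<dots> = (\<Prod>k\<in>K. if k \<in> I then 1 / 2 else 1)"
      using \<sigma>(1) by (intro prod.cong) (auto simp: integral_pmf_of_set h_def \<sigma>_def)
    finally show ?thesis using half K by (simp add: Int_absorb2)
  qed
  have EHk: "?E (\<lambda>\<omega>. ?H \<omega> * \<omega> m) = (if m \<in> I then \<sigma> m * (1 / 2) ^ card I else 0)" if m: "m \<in> K" for m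
  proof -
    \<comment> \<open>Adding 1 keeps every factor nonnegative on the values -1 and 1 while the
      expectation of the product is factorised; the known \<open>?E ?H\<close> is subtracted
      afterwards.\<close>
    have "?E (\<lambda>\<omega>. ?H \<omega> * (1 + \<omega> m)) = ?E (\<lambda>\<omega>. \<Prod>k\<in>K. h k (\<omega> k) * (if k = m then 1 + \<omega> k else 1))"
      using K m by (simp add: prod.distrib)
    also have "\<dots> = (\<Prod>k\<in>K. measure_pmf.expectation (pmf_of_set {-1, 1}) (\<lambda>v. h k v * (if k = m then 1 + v else 1)))"
      using K by (intro expectation_prod_Pi_pmf) (auto intro: integrable_measure_pmf_finite simp: h_def)
    also have "\<dots> = (\<Prod>k\<in>K. (if k \<in> I then 1 / 2 else 1) * (if k = m then (if m \<in> I then 1 + \<sigma> m else 1) else 1))"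
      using \<sigma>(1) by (intro prod.cong) (auto simp: integral_pmf_of_set h_def \<sigma>_def)
    also have "\<dots> = (1 / 2) ^ card I * (if m \<in> I then 1 + \<sigma> m else 1)"
      using K m half by (simp add: prod.distrib Int_absorb2)
    finally have "?E ?H + ?E (\<lambda>\<omega>. ?H \<omega> * \<omega> m) = (1 / 2) ^ card I * (if m \<in> I then 1 + \<sigma> m else 1)"
      using K by (simp add: distrib_left)
    then show ?thesis using EH by (auto simp: algebra_simps split: if_splits)
  qed
  have EHS: "?E (\<lambda>\<omega>. ?H \<omega> * ?S \<omega>) = b * (1 / 2) ^ card I"
  proof -
    have "?E (\<lambda>\<omega>. ?H \<omega> * ?S \<omega>) = ?E (\<lambda>\<omega>. \<Sum>m\<in>K. c m * (?H \<omega> * \<omega> m))"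
      by (simp add: sum_distrib_left mult_ac)
    also have "\<dots> = (\<Sum>m\<in>K. c m * ?E (\<lambda>\<omega>. ?H \<omega> * \<omega> m))"
      using K by (subst Bochner_Integration.integral_sum) auto
    also have "\<dots> = (\<Sum>m\<in>K. if m \<in> I then \<bar>c m\<bar> * (1 / 2) ^ card I else 0)"
      using EHk \<sigma>(2) by (intro sum.cong) (auto simp: mult.assoc[symmetric])
    also have "\<dots> = b * (1 / 2) ^ card I"
      using K by (simp add: sum.If_cases Int_absorb1 b_def sum_distrib_right)
    finally show ?thesis .
  qed
  \<comment> \<open>The tangent at \<open>b\<close> of the convex function \<open>\<bar>\<cdot>\<bar> powr p\<close> replaces the conditional Jensen inequality.\<close>
  have tangent: "b powr p + p * b powr (p - 1) * (s - b) \<le> \<bar>s\<bar> powr p" for s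
  proof -
    have "b powr p + p * b powr (p - 1) * (s - b) \<le> b powr p + p * b powr (p - 1) * (\<bar>s\<bar> - b)"
      using p b by (intro add_mono mult_left_mono) auto
    also have "\<dots> \<le> \<bar>s\<bar> powr p"
    \<comment> \<open>The tangent inequality is taken on the open half-line; at 0 the claim reads
      \<open>(1 - p) * b powr p \<le> 0\<close>.\<close>
    proof (cases "s = 0")
      case True
      then show ?thesis using p b by (simp add: powr_mult_base[of b "p - 1"] mult_ac)
    next
      case False
      have "p * b powr (p - 1) * (\<bar>s\<bar> - b) \<le> \<bar>s\<bar> powr p - b powr p"
      proof (rule convex_on_imp_above_tangent[of "{0<..}" "\<lambda>x. x powr p"])
        show "convex_on {0<..} (\<lambda>x. x powr p)" using p(1) by (rule powr_convex)
        show "((\<lambda>x. x powr p) has_real_derivative p * b powr (p - 1)) (at b within {0<..})"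
          using b by (auto intro!: derivative_eq_intros)
      qed (use b False in \<open>auto simp: interior_open\<close>)
      then show ?thesis by simp
    qed
    finally show ?thesis .
  qed
  \<comment> \<open>The probability of the event is at least \<open>(1 / 2) powr p\<close> because
    \<open>card I \<le> p\<close>; its \<open>p\<close>-th root is the constant 1/2.\<close>
  have "(b / 2) powr p \<le> b powr p * (1 / 2) ^ card I"
  proof -
    have "(1 / 2) powr p \<le> (1 / 2 :: real) powr card I"
      using p by (intro powr_mono') auto
    then show ?thesis using b by (simp add: powr_divide powr_realpow field_simps)
  qed
  also have "\<dots> = ?E (\<lambda>\<omega>. ?H \<omega> * (b powr p + p * b powr (p - 1) * (?S \<omega> - b)))"
  proof -
    have "?E (\<lambda>\<omega>. ?H \<omega> * (b powr p + p * b powr (p - 1) * (?S \<omega> - b)))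
      = ?E (\<lambda>\<omega>. (b powr p - p * b powr (p - 1) * b) * ?H \<omega> + p * b powr (p - 1) * (?H \<omega> * ?S \<omega>))"
      by (simp add: algebra_simps)
    also have "\<dots> = (b powr p - p * b powr (p - 1) * b) * ?E ?H + p * b powr (p - 1) * ?E (\<lambda>\<omega>. ?H \<omega> * ?S \<omega>)"
      using K by (subst Bochner_Integration.integral_add) auto
    finally show ?thesis unfolding EH EHS by (simp add: algebra_simps)
  qed
  also have "\<dots> \<le> ?E (\<lambda>\<omega>. \<bar>?S \<omega>\<bar> powr p)"
  proof (rule integral_mono)
    fix \<omega>
    have "0 \<le> ?H \<omega>" "?H \<omega> \<le> 1" by (auto intro!: prod_nonneg prod_le_1 simp: h_def)
    then have "?H \<omega> * (b powr p + p * b powr (p - 1) * (?S \<omega> - b)) \<le> ?H \<omega> * \<bar>?S \<omega>\<bar> powr p"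
      by (intro mult_left_mono tangent)
    also have "\<dots> \<le> 1 * \<bar>?S \<omega>\<bar> powr p"
      using \<open>?H \<omega> \<le> 1\<close> by (intro mult_right_mono) auto
    finally show "?H \<omega> * (b powr p + p * b powr (p - 1) * (?S \<omega> - b)) \<le> \<bar>?S \<omega>\<bar> powr p" by simp
  qed (use K in auto)
  finally have "((b / 2) powr p) powr (1 / p) \<le> (?E (\<lambda>\<omega>. \<bar>?S \<omega>\<bar> powr p)) powr (1 / p)"
    using p by (intro powr_mono2) auto
  then show ?thesis
    using p b by (simp add: powr_powr Lp_norm_def b_def)
qed

section \<open>Operator norms and the sign chaos\<close>

text \<open>A real \<open>SUP\<close> is informative only over a set bounded above; the sum of all
  absolute entries is a crude bound.\<close>

lemma bdd_above_op_norm: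
  fixes n :: nat
  shows "bdd_above ((\<lambda>x. L2_set (\<lambda>i. \<Sum>j\<in>{1..n}. B i j * x j) {1..n}) ` {x. L2_set x {1..n} \<le> 1})"
proof (rule bdd_aboveI2)
  fix x assume x: "x \<in> {x. L2_set x {1..n} \<le> 1}"
  have "L2_set (\<lambda>i. \<Sum>j\<in>{1..n}. B i j * x j) {1..n} \<le> (\<Sum>i\<in>{1..n}. \<bar>\<Sum>j\<in>{1..n}. B i j * x j\<bar>)"
    by (rule L2_set_le_sum_abs)
  also have "\<dots> \<le> (\<Sum>i\<in>{1..n}. \<Sum>j\<in>{1..n}. \<bar>B i j\<bar>)"
  proof (intro sum_mono order_trans[OF sum_abs])
    fix i j assume "j \<in> {1..n}"
    then have "\<bar>x j\<bar> \<le> L2_set (\<lambda>j. \<bar>x j\<bar>) {1..n}"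
      by (intro member_le_L2_set) auto
    also have "\<dots> = L2_set x {1..n}" by (simp add: L2_set_def)
    finally have "\<bar>x j\<bar> \<le> 1" using x by simp
    then show "\<bar>B i j * x j\<bar> \<le> \<bar>B i j\<bar>" by (simp add: abs_mult mult_left_le)
  qed
  finally show "L2_set (\<lambda>i. \<Sum>j\<in>{1..n}. B i j * x j) {1..n} \<le> (\<Sum>i\<in>{1..n}. \<Sum>j\<in>{1..n}. \<bar>B i j\<bar>)" .
qed

lemma op_norm_upper:
  "L2_set x {1..n} \<le> 1 \<Longrightarrow> L2_set (\<lambda>i. \<Sum>j\<in>{1..n}. B i j * x j) {1..n} \<le> op_norm n B"
  unfolding op_norm_def by (rule cSUP_upper[OF _ bdd_above_op_norm]) simp

lemma op_norm_nonneg: "0 \<le> op_norm n B"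
  using op_norm_upper[of "\<lambda>_. 0" n B] by (simp add: L2_set_def)

text \<open>Normalise \<open>t\<close> and apply the Cauchy-Schwarz inequality to \<open>s\<close>
  and the image of the normalised vector.\<close>

lemma bilinear_le_op_norm:
  "(\<Sum>i\<in>{1..n}. \<Sum>j\<in>{1..n}. B i j * s i * t j) \<le> op_norm n B * (L2_set s {1..n} * L2_set t {1..n})"
proof (cases "L2_set t {1..n} = 0")
  case True
  then have "\<forall>j\<in>{1..n}. t j = 0" by (subst (asm) L2_set_eq_0_iff) auto
  then show ?thesis using True by simp
next
  case False
  then have t: "L2_set t {1..n} > 0" by (simp add: less_le)
  let ?u = "\<lambda>j. t j / L2_set t {1..n}"
  let ?Bu = "\<lambda>i. \<Sum>j\<in>{1..n}. B i j * ?u j"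
  have "L2_set ?u {1..n} = 1"
    using L2_set_left_distrib[of "inverse (L2_set t {1..n})" t "{1..n}"] t by (simp add: field_simps)
  then have u: "L2_set ?Bu {1..n} \<le> op_norm n B" by (intro op_norm_upper) simp
  have "(\<Sum>i\<in>{1..n}. \<Sum>j\<in>{1..n}. B i j * s i * t j) = L2_set t {1..n} * (\<Sum>i\<in>{1..n}. s i * ?Bu i)"
    using t by (simp add: sum_distrib_left field_simps)
  also have "\<dots> \<le> L2_set t {1..n} * (\<Sum>i\<in>{1..n}. \<bar>s i\<bar> * \<bar>?Bu i\<bar>)"
    using t by (intro mult_left_mono sum_mono) (auto simp: abs_mult[symmetric] simp del: times_divide_eq_right)
  also have "\<dots> \<le> L2_set t {1..n} * (L2_set s {1..n} * op_norm n B)"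
    using t u by (intro mult_left_mono order_trans[OF L2_set_mult_ineq]) auto
  finally show ?thesis by (simp add: mult_ac)
qed

lemma sum_restrict_abs:
  assumes "I \<subseteq> {1..n} \<times> {1..n}"
  shows "(\<Sum>i\<in>{1..n}. \<Sum>j\<in>{1..n}. restrict_abs A I i j * x i * y j) = (\<Sum>(i, j)\<in>I. \<bar>A i j\<bar> * x i * y j)"
proof -
  have "(\<Sum>i\<in>{1..n}. \<Sum>j\<in>{1..n}. restrict_abs A I i j * x i * y j)
      = (\<Sum>e\<in>{1..n} \<times> {1..n}. if e \<in> I then \<bar>A (fst e) (snd e)\<bar> * x (fst e) * y (snd e) else 0)"
    unfolding sum.cartesian_product by (intro sum.cong) (auto simp: restrict_abs_def)
  also have "\<dots> = (\<Sum>e\<in>I. \<bar>A (fst e) (snd e)\<bar> * x (fst e) * y (snd e))"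
    using assms by (subst sum.inter_restrict[symmetric]) (auto simp: Int_absorb1)
  finally show ?thesis by (simp add: split_def)
qed

lemma op_norm_le_max_restricted_norm:
  fixes p :: real
  assumes "I \<subseteq> {1..n} \<times> {1..n}" "real (card I) \<le> p"
  shows "op_norm n (restrict_abs A I) \<le> max_restricted_norm n A p"
  unfolding max_restricted_norm_def using assms
  by (intro Max_ge finite_imageI) (auto intro: finite_subset[of _ "Pow ({1..n} \<times> {1..n})"])

lemma max_restricted_norm_attained:
  fixes p :: real
  assumes "p \<ge> 0"
  obtains I where "I \<subseteq> {1..n} \<times> {1..n}" "real (card I) \<le> p"
    "max_restricted_norm n A p = op_norm n (restrict_abs A I)"
proof -
  let ?F = "{I. I \<subseteq> {1..n} \<times> {1..n} \<and> real (card I) \<le> p}"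
  have "finite ?F" by (rule finite_subset[of _ "Pow ({1..n} \<times> {1..n})"]) auto
  moreover have "{} \<in> ?F" using assms by simp
  ultimately have "max_restricted_norm n A p \<in> (\<lambda>I. op_norm n (restrict_abs A I)) ` ?F"
    unfolding max_restricted_norm_def by (intro Max_in) blast+
  then show ?thesis using that by auto
qed

text \<open>The real bound \<open>p\<close> on cardinalities is replaced by the integer
  \<open>nat \<lfloor>p\<rfloor>\<close>, which is at least 1.\<close>

lemma sparse_bilinear_bound_max_restricted_norm:
  fixes p :: real
  assumes "p \<ge> 1"
  shows "sparse_bilinear_bound {1..n} {1..n} (\<lambda>i j. \<bar>A i j\<bar>) (nat \<lfloor>p\<rfloor>) (max_restricted_norm n A p)"
proof
  show "1 \<le> nat \<lfloor>p\<rfloor>" using assms by linarith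
  show "0 \<le> max_restricted_norm n A p"
    using op_norm_le_max_restricted_norm[of "{}" n p A] op_norm_nonneg[of n] assms by (force intro: order_trans)
  fix I x y assume I: "I \<subseteq> {1..n} \<times> {1..n}" "card I \<le> nat \<lfloor>p\<rfloor>"
  then have "real (card I) \<le> p" using assms by linarith
  then have "op_norm n (restrict_abs A I) * (L2_set x {1..n} * L2_set y {1..n})
      \<le> max_restricted_norm n A p * (L2_set x {1..n} * L2_set y {1..n})"
    using I by (intro mult_right_mono op_norm_le_max_restricted_norm) auto
  then show "(\<Sum>(i, j)\<in>I. \<bar>A i j\<bar> * x i * y j)
      \<le> max_restricted_norm n A p * (L2_set x {1..n} * L2_set y {1..n})"
    unfolding sum_restrict_abs[OF I(1), symmetric] by (rule order_trans[OF bilinear_le_op_norm])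
qed auto

section \<open>Two-sided comparison of the chaos with the maximal restricted norm\<close>

lemma Lp_norm_bilinear_signs_le:
  fixes p :: real
  assumes p: "p \<ge> 1" and s: "L2_set s {1..n} \<le> 1" and t: "L2_set t {1..n} \<le> 1"
  shows "Lp_norm (sign_pmf n) p (\<lambda>\<omega>. \<Sum>i\<in>{1..n}. \<Sum>j\<in>{1..n}. A i j * \<omega> (i, j) * s i * t j)
    \<le> 300 * sqrt (ln (p + 1)) * max_restricted_norm n A p"
proof -
  define K where "K = {1..n} \<times> {1..n}"
  define M where "M = max_restricted_norm n A p"
  define q where "q = nat \<lfloor>p\<rfloor>"
  interpret sparse_bilinear_bound "{1..n}" "{1..n}" "\<lambda>i j. \<bar>A i j\<bar>" q M
    unfolding q_def M_def using p by (rule sparse_bilinear_bound_max_restricted_norm)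
  have "real q = of_int \<lfloor>p\<rfloor>" "\<lfloor>p\<rfloor> \<ge> 1" using p by (simp_all add: q_def)
  then have pq: "q \<le> p" "p \<le> 2 * real q" by linarith+
  \<comment> \<open>The least number of halvings with \<open>q \<le> 2 ^ L\<close>, so that
    \<open>L\<close> is of order \<open>ln (p + 1)\<close>.\<close>
  define L where "L = nat \<lceil>log 2 q\<rceil>"
  have L: "log 2 q \<le> L" "L \<le> log 2 q + 1" using q unfolding L_def by (simp_all add: zero_le_log_cancel_iff)
  have "real q = 2 powr log 2 q" using q by simp
  also have "\<dots> \<le> 2 powr L" using L by (intro powr_mono) auto
  finally have "q \<le> 2 ^ L" by (simp add: powr_realpow)
  define c where "c e = A (fst e) (snd e) * s (fst e) * t (snd e)" for e
  have abs_c: "\<bar>c e\<bar> = \<bar>A (fst e) (snd e)\<bar> * \<bar>s (fst e)\<bar> * \<bar>t (snd e)\<bar>" for e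
    by (simp add: c_def abs_mult)
  have "\<exists>T\<subseteq>K. (\<Sum>e\<in>T. \<bar>c e\<bar>) \<le> M \<and> q * (\<Sum>e\<in>K - T. \<bar>c e\<bar>\<^sup>2) \<le> (2 + 144 * real L) * M\<^sup>2"
    unfolding abs_c K_def
    by (rule head_tail_decomposition) (use s t \<open>q \<le> 2 ^ L\<close> in \<open>auto simp: L2_set_def\<close>)
  then obtain T where T: "T \<subseteq> K" "(\<Sum>e\<in>T. \<bar>c e\<bar>) \<le> M"
    "q * (\<Sum>e\<in>K - T. (c e)\<^sup>2) \<le> (2 + 144 * real L) * M\<^sup>2"
    by auto
  \<comment> \<open>\<open>D\<^sup>2\<close> is the tail bound, and
    \<open>D * sqrt p \<ge> M\<close> because \<open>p / q \<ge> 1\<close>, which covers the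
    head.\<close>
  define D where "D = sqrt ((2 + 144 * real L) / q) * M"
  have Dp: "sqrt p * D = sqrt ((2 + 144 * real L) * (p / q)) * M"
    using p by (simp add: D_def real_sqrt_mult real_sqrt_divide)
  have "1 * 1 \<le> (2 + 144 * real L) * (p / q)"
    using pq q by (intro mult_mono) auto
  then have "1 * M \<le> sqrt p * D"
    unfolding Dp using M by (intro mult_right_mono) auto
  then have head: "(\<Sum>e\<in>T. \<bar>c e\<bar>) \<le> D * sqrt p" using T by (simp add: mult.commute)
  have tail: "(\<Sum>e\<in>K - T. (c e)\<^sup>2) \<le> D\<^sup>2"
    using T q by (simp add: D_def power_mult_distrib field_simps)
  have "(\<lambda>\<omega>. \<Sum>i\<in>{1..n}. \<Sum>j\<in>{1..n}. A i j * \<omega> (i, j) * s i * t j) = (\<lambda>\<omega>. \<Sum>e\<in>K. c e * \<omega> e)"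
    by (simp add: K_def c_def sum.cartesian_product split_def mult_ac)
  then have "Lp_norm (sign_pmf n) p (\<lambda>\<omega>. \<Sum>i\<in>{1..n}. \<Sum>j\<in>{1..n}. A i j * \<omega> (i, j) * s i * t j)
      = Lp_norm (sign_vectors K) p (\<lambda>\<omega>. \<Sum>e\<in>K. c e * \<omega> e)"
    by (simp add: sign_pmf_def K_def)
  also have "\<dots> \<le> 10 * sqrt p * D"
    by (rule Lp_norm_signs_le[OF _ T(1) p _ head tail]) (use M in \<open>auto simp: K_def D_def\<close>)
  also have "\<dots> = 10 * (sqrt ((2 + 144 * real L) * (p / q)) * M)" using Dp by simp
  \<comment> \<open>As \<open>ln (p + 1) \<ge> ln 2 \<ge> 2 / 3\<close>, additive constants are
    absorbed by the logarithm: \<open>2 + 144 * L\<close> is at most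
    \<open>450 * ln (p + 1)\<close>. Since \<open>p / q \<le> 2\<close>, this becomes 900, and the
    final constant is \<open>300 = 10 * sqrt 900\<close>.\<close>
  also have "\<dots> \<le> 10 * (sqrt (900 * ln (p + 1)) * M)"
  proof -
    have ln2: "1 \<le> 3 / 2 * ln (2 :: real)" using ln2_ge_two_thirds by simp
    have lnp: "ln 2 \<le> ln (p + 1)" using p by simp
    have "log 2 q \<le> ln (p + 1) / ln 2"
      using pq q by (simp add: log_def divide_right_mono)
    also have "\<dots> \<le> 3 / 2 * ln (p + 1)"
      using ln2 lnp mult_right_mono[OF ln2, of "ln (p + 1)"] by (simp add: field_simps)
    finally have "2 + 144 * real L \<le> 450 * ln (p + 1)" using L ln2 lnp by linarith
    moreover have "p / q \<le> 2" using pq q by (simp add: field_simps)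
    ultimately have "(2 + 144 * real L) * (p / q) \<le> (450 * ln (p + 1)) * 2"
      using p lnp by (intro mult_mono) auto
    then show ?thesis using M by (intro mult_left_mono mult_right_mono) auto
  qed
  also have "\<dots> = 300 * sqrt (ln (p + 1)) * M" by (simp add: real_sqrt_mult)
  finally show ?thesis unfolding M_def .
qed

lemma Lp_norm_bilinear_signs_ge:
  fixes p :: real
  assumes p: "p \<ge> 1" and I: "I \<subseteq> {1..n} \<times> {1..n}" "real (card I) \<le> p"
  shows "1 / 2 * (\<Sum>i\<in>{1..n}. \<Sum>j\<in>{1..n}. restrict_abs A I i j * s i * t j)
    \<le> Lp_norm (sign_pmf n) p (\<lambda>\<omega>. \<Sum>i\<in>{1..n}. \<Sum>j\<in>{1..n}. A i j * \<omega> (i, j) * s i * t j)"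
proof -
  define K where "K = {1..n} \<times> {1..n}"
  define c where "c e = A (fst e) (snd e) * s (fst e) * t (snd e)" for e
  have "(\<Sum>i\<in>{1..n}. \<Sum>j\<in>{1..n}. restrict_abs A I i j * s i * t j) \<le> (\<Sum>e\<in>I. \<bar>c e\<bar>)"
    unfolding sum_restrict_abs[OF I(1)] split_def
    by (intro sum_mono) (auto simp: c_def abs_mult mult.assoc intro!: mult_left_mono simp flip: abs_mult)
  also have "(\<Sum>e\<in>I. \<bar>c e\<bar>) / 2 \<le> Lp_norm (sign_vectors K) p (\<lambda>\<omega>. \<Sum>e\<in>K. c e * \<omega> e)"
    using p I by (intro Lp_norm_signs_ge) (auto simp: K_def)
  also have "(\<lambda>\<omega>. \<Sum>e\<in>K. c e * \<omega> e) = (\<lambda>\<omega>. \<Sum>i\<in>{1..n}. \<Sum>j\<in>{1..n}. A i j * \<omega> (i, j) * s i * t j)"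
    by (simp add: K_def c_def sum.cartesian_product split_def mult_ac)
  finally show ?thesis by (simp add: sign_pmf_def K_def)
qed

lemma eps_norm_le:
  fixes p :: real
  assumes "p \<ge> 1"
  shows "eps_norm n p A \<le> 300 * sqrt (ln (p + 1)) * max_restricted_norm n A p"
  unfolding eps_norm_def eps_norm_on_def
proof (rule cSUP_least)
  have "(\<lambda>_. 0, \<lambda>_. 0) \<in> {(s, t). L2_set s {1..n} \<le> 1 \<and> L2_set t {1..n} \<le> 1}"
    by (simp add: L2_set_def)
  then show "{(s, t). L2_set s {1..n} \<le> 1 \<and> L2_set t {1..n} \<le> 1} \<noteq> {}" by blast
qed (use Lp_norm_bilinear_signs_le[OF assms] in auto)

text \<open>The upper estimate just proved is uniform in \<open>s\<close> and \<open>t\<close>, so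
  it also shows that the supremum is over a bounded set.\<close>

lemma eps_norm_upper:
  fixes p :: real
  assumes p: "p \<ge> 1" and s: "L2_set s {1..n} \<le> 1" and t: "L2_set t {1..n} \<le> 1"
  shows "Lp_norm (sign_pmf n) p (\<lambda>\<omega>. \<Sum>i\<in>{1..n}. \<Sum>j\<in>{1..n}. A i j * \<omega> (i, j) * s i * t j) \<le> eps_norm n p A"
proof -
  let ?f = "\<lambda>(s, t). Lp_norm (sign_pmf n) p (\<lambda>\<omega>. \<Sum>i\<in>{1..n}. \<Sum>j\<in>{1..n}. A i j * \<omega> (i, j) * s i * t j)"
  have "bdd_above (?f ` {(s, t). L2_set s {1..n} \<le> 1 \<and> L2_set t {1..n} \<le> 1})"
    by (rule bdd_aboveI2) (use Lp_norm_bilinear_signs_le[OF p] in auto)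
  from cSUP_upper[OF _ this, of "(s, t)"] s t show ?thesis
    by (simp add: eps_norm_def eps_norm_on_def)
qed

text \<open>For a maximising \<open>I\<close> and any \<open>t\<close>, choosing \<open>s\<close> as
  the normalised image of \<open>t\<close> turns the restricted bilinear form into the norm of that
  image.\<close>

lemma eps_norm_ge:
  fixes p :: real
  assumes p: "p \<ge> 1"
  shows "1 / 2 * max_restricted_norm n A p \<le> eps_norm n p A"
proof -
  obtain I where I: "I \<subseteq> {1..n} \<times> {1..n}" "real (card I) \<le> p"
    and max: "max_restricted_norm n A p = op_norm n (restrict_abs A I)"
    using max_restricted_norm_attained[of p n A] p by auto
  have "op_norm n (restrict_abs A I) \<le> 2 * eps_norm n p A"
    unfolding op_norm_def
  proof (rule cSUP_least)
    have "(\<lambda>_. 0) \<in> {x. L2_set x {1..n} \<le> 1}" by (simp add: L2_set_def)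
    then show "{x. L2_set x {1..n} \<le> 1} \<noteq> {}" by blast
  next
    fix t assume "t \<in> {x. L2_set x {1..n} \<le> 1}"
    then have t: "L2_set t {1..n} \<le> 1" by simp
    define z where "z i = (\<Sum>j\<in>{1..n}. restrict_abs A I i j * t j)" for i
    define r where "r = L2_set z {1..n}"
    \<comment> \<open>If \<open>r = 0\<close>, division by zero makes this the zero vector, and no case distinction is needed.\<close>
    define s where "s i = z i / r" for i
    have r: "r \<ge> 0" "(\<Sum>i\<in>{1..n}. (z i)\<^sup>2) = r\<^sup>2" by (simp_all add: r_def L2_set_def sum_nonneg)
    have "L2_set s {1..n} = r * inverse r"
      using L2_set_left_distrib[of "inverse r" z "{1..n}"] r by (simp add: r_def s_def[abs_def] divide_inverse)
    then have s: "L2_set s {1..n} \<le> 1" by (cases "r = 0") auto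
    have "(\<Sum>i\<in>{1..n}. \<Sum>j\<in>{1..n}. restrict_abs A I i j * s i * t j) = (\<Sum>i\<in>{1..n}. (z i)\<^sup>2) / r"
      by (simp add: s_def z_def power2_eq_square sum_distrib_left sum_distrib_right sum_divide_distrib mult_ac)
    also have "\<dots> = r" using r by (simp add: power2_eq_square)
    finally have "1 / 2 * r \<le> eps_norm n p A"
      using Lp_norm_bilinear_signs_ge[OF p I, of A s t] eps_norm_upper[OF p s t, of A] by simp
    then show "L2_set (\<lambda>i. \<Sum>j\<in>{1..n}. restrict_abs A I i j * t j) {1..n} \<le> 2 * eps_norm n p A"
      by (simp add: r_def z_def[abs_def])
  qed
  then show ?thesis using max by simp
qed

theorem proposition1p5:
  shows "\<exists>C::real. C > 0 \<and>
    (\<forall>(n::nat) (A :: nat \<Rightarrow> nat \<Rightarrow> real) (p::real). n \<ge> 1 \<longrightarrow> p \<ge> 1 \<longrightarrow>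
       1 / 2 * max_restricted_norm n A p \<le> eps_norm n p A \<and>
       eps_norm n p A \<le> C * sqrt (ln (p + 1)) * max_restricted_norm n A p)"
  by (rule exI[of _ 300]) (auto intro: eps_norm_le eps_norm_ge simp del: One_nat_def times_divide_eq_left)

end
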